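(* Let $n\ge 6$ and let $(a_{ijk})_{0\le i<j<k\le n}$ be a family of real numbers. Then the set of volumes of all $n$-simplices in $\mathbb{R}^n$ with vertices $p_0,\dots,p_n$ such that the area of the $2$-face $p_ip_jp_k$ equals $a_{ijk}$ for all $0\le i<j<k\le n$ is finite.
   Context: An $n$-simplex in $\mathbb{R}^n$ is non-degenerate, i.e. its vertices are affinely independent. *)

theory Defs
  imports "HOL-Analysis.Analysis"
begin

text \<open>
  The area of a triangle in a Euclidean space of any dimension is the planar Lebesgue measure
  of a triangle in the plane congruent to it (equal side lengths). By Heron's formula in the plane
  this does not depend on the congruent copy, and such a copy always exists, so the description is
  proper: see \<open>triangle_area_eq\<close> and \<open>ex_congruent_triangle\<close> below.
\<close>

definition triangle_area :: "'a::euclidean_space \<Rightarrow> 'a \<Rightarrow> 'a \<Rightarrow> real" where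
  "triangle_area p q r =
     (THE A. \<exists>x y z :: real^2. dist x y = dist p q \<and> dist x z = dist p r \<and> dist y z = dist q r
                \<and> A = measure lborel (convex hull {x, y, z}))"

definition nondegenerate_simplex :: "nat \<Rightarrow> (nat \<Rightarrow> 'a::euclidean_space) \<Rightarrow> bool" where
  "nondegenerate_simplex n p \<longleftrightarrow> inj_on p {0..n} \<and> \<not> affine_dependent (p ` {0..n})"

lemma nondegenerate_simplex_imp_simplex:
  "nondegenerate_simplex n p \<Longrightarrow> int n simplex (convex hull (p ` {0..n}))"
  by (auto simp: nondegenerate_simplex_def card_image intro!: simplex_convex_hull)

lemma triangle_area_eq:
  fixes p q r :: "'a::euclidean_space" and x y z :: "real^2"
  assumes "dist x y = dist p q" "dist x z = dist p r" "dist y z = dist q r"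
  shows "triangle_area p q r = measure lborel (convex hull {x, y, z})"
  unfolding triangle_area_def
proof (rule the_equality)
  show "\<exists>x' y' z' :: real^2. dist x' y' = dist p q \<and> dist x' z' = dist p r \<and> dist y' z' = dist q r
          \<and> measure lborel (convex hull {x, y, z}) = measure lborel (convex hull {x', y', z'})"
    using assms by blast
qed (use assms in \<open>auto simp: heron\<close>)

lemma ex_congruent_triangle:
  fixes p q r :: "'a::euclidean_space"
  shows "\<exists>x y z :: real^2. dist x y = dist p q \<and> dist x z = dist p r \<and> dist y z = dist q r"
proof -
  define u v where "u = q - p" and "v = r - p"
  define y z :: "real^2" where
    "y = vector [norm u, 0]" and
    "z = (if u = 0 then vector [norm v, 0]
          else vector [(u \<bullet> v) / norm u, sqrt ((norm v)\<^sup>2 - ((u \<bullet> v) / norm u)\<^sup>2)])"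
  have yz: "y \<bullet> y = u \<bullet> u" "z \<bullet> z = v \<bullet> v" "y \<bullet> z = u \<bullet> v"
  proof -
    show "y \<bullet> y = u \<bullet> u"
      by (simp add: y_def inner_vec_def sum_2 power2_norm_eq_inner flip: power2_eq_square)
    show "z \<bullet> z = v \<bullet> v"
    proof (cases "u = 0")
      case True
      then show ?thesis
        by (simp add: z_def inner_vec_def sum_2 power2_norm_eq_inner flip: power2_eq_square)
    next
      case False
      have "\<bar>(u \<bullet> v) / norm u\<bar> \<le> norm v"
        using Cauchy_Schwarz_ineq2[of u v] False by (simp add: field_simps)
      then have "((u \<bullet> v) / norm u)\<^sup>2 \<le> (norm v)\<^sup>2"
        by (metis abs_norm_cancel abs_le_square_iff)
      then show ?thesis using False
        by (simp add: z_def inner_vec_def sum_2 power2_norm_eq_inner flip: power2_eq_square)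
    qed
    show "y \<bullet> z = u \<bullet> v"
      by (simp add: y_def z_def inner_vec_def sum_2)
  qed
  have "dist 0 y = dist p q"
  proof -
    have "norm y = norm u" using yz by (simp add: norm_eq)
    then show ?thesis by (simp add: u_def dist_norm norm_minus_commute)
  qed
  moreover have "dist 0 z = dist p r"
  proof -
    have "norm z = norm v" using yz by (simp add: norm_eq)
    then show ?thesis by (simp add: v_def dist_norm norm_minus_commute)
  qed
  moreover have "dist y z = dist q r"
  proof -
    have "(y - z) \<bullet> (y - z) = (u - v) \<bullet> (u - v)"
      using yz by (simp add: algebra_simps inner_commute)
    then have "norm (y - z) = norm (u - v)" by (simp add: norm_eq)
    then show ?thesis by (simp add: u_def v_def dist_norm)
  qed
  ultimately show ?thesis by blast
qed

lemma triangle_area_plane: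
  fixes p q r :: "real^2"
  shows "triangle_area p q r = measure lborel (convex hull {p, q, r})"
  by (rule triangle_area_eq) auto

lemma triangle_area_heron:
  fixes p q r :: "'a::euclidean_space"
  defines "s \<equiv> (dist q r + dist p r + dist p q) / 2"
  shows "triangle_area p q r = sqrt (s * (s - dist q r) * (s - dist p r) * (s - dist p q))"
proof -
  obtain x y z :: "real^2" where
    *: "dist x y = dist p q" "dist x z = dist p r" "dist y z = dist q r"
    using ex_congruent_triangle[of p q r] by blast
  show ?thesis unfolding triangle_area_eq[OF *] heron s_def by (simp add: *)
qed

end

theory Submission
  imports
    Defs
    "HOL-Computational_Algebra.Polynomial"
    "HOL-Library.Function_Algebras"
begin

text \<open>
  Suppose that infinitely many volumes occur and choose simplices with pairwise distinct nonzero
  volumes. Regard sequences of reals as elements of an ultrapower \<open>K\<close> of the reals: the squared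
  edge lengths of the chosen simplices become elements \<open>x i j\<close> of \<open>K\<close>, the squared areas of the
  triangles are nonzero real constants, and the Gram determinant \<open>W\<close>, a fixed multiple of the squared
  volume, is transcendental over the reals. By Chevalley's extension theorem
  (\<open>ex_valuation_subring\<close>) there is a valuation ring \<open>R\<close> of \<open>K\<close> that contains the reals but
  not \<open>W\<close>. Call the elements of \<open>R\<close> finite. The areas are then units of \<open>R\<close>
  while the volume is infinite, and \<open>gram_det_mem\<close> says that this is impossible.

  The reason is as follows. Let \<open>L = x a b\<close> be an edge of which all \<open>x i j\<close> are finite multiples. It is
  infinite, since otherwise \<open>W\<close>, a polynomial in the edges, is finite. After division by \<open>L\<close>
  all \<open>y i j = x i j / L\<close> are finite and, with \<open>e = 1 / L\<^sup>2\<close>, every triangle is degenerate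
  modulo \<open>e\<close>. Reduced modulo the maximal ideal, five or more points
  whose triangles are all degenerate form two clusters, or lie on a line in at least three clusters, or
  form four clusters with the distances of a tetrahedron that has equal opposite edges and degenerate
  faces. (Such a tetrahedron does not exist in Euclidean space, but the equations do not exclude it.) Two
  clusters cannot occur, because one of them would contain three points, and the area of their triangle
  would not be a unit. In the other
  cases there are functions \<open>p\<close>, \<open>q\<close>, \<open>r\<close> on the vertices such that
  \<open>y i j\<close> is congruent to \<open>(p i - p j)\<^sup>2 - 4 * (q i - q j) * (r i - r j)\<close> modulo \<open>e\<close>
  (\<open>distances_rank_three\<close>): the points sit in a quadratic space of dimension three.

  Consequently the Gram matrix of \<open>y\<close> is a matrix of rank at most three plus multiples of \<open>e\<close>,
  and its determinant is a multiple of \<open>e ^ (n - 3)\<close> (\<open>det_low_rank_rows\<close>). Scaling back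
  multiplies by \<open>L ^ n\<close>, so that \<open>W\<close> is a finite multiple of \<open>L ^ n / L ^ (2 * (n - 3))\<close>,
  that is of \<open>1 / L ^ (n - 6)\<close>. For \<open>n \<ge> 6\<close> this is finite.
\<close>

section \<open>Subrings of a field, units and principal ideals\<close>

locale field_subring =
  fixes R :: "'k::field_char_0 set"
  assumes one_mem: "1 \<in> R"
    and diff_mem: "x \<in> R \<Longrightarrow> y \<in> R \<Longrightarrow> x - y \<in> R"
    and mult_mem: "x \<in> R \<Longrightarrow> y \<in> R \<Longrightarrow> x * y \<in> R"
begin

lemma zero_mem: "0 \<in> R"
  using diff_mem[OF one_mem one_mem] by simp

lemma minus_mem: "x \<in> R \<Longrightarrow> - x \<in> R"
  using diff_mem[OF zero_mem] by force

lemma add_mem: "x \<in> R \<Longrightarrow> y \<in> R \<Longrightarrow> x + y \<in> R"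
  using diff_mem[OF _ minus_mem] by force

lemma of_nat_mem: "of_nat m \<in> R"
  by (induction m) (auto intro: zero_mem one_mem add_mem)

lemma numeral_mem: "numeral w \<in> R"
  using of_nat_mem[of "numeral w"] by simp

lemma power_mem: "x \<in> R \<Longrightarrow> x ^ m \<in> R"
  by (induction m) (auto intro: one_mem mult_mem)

lemma sum_mem: "(\<And>i. i \<in> A \<Longrightarrow> f i \<in> R) \<Longrightarrow> sum f A \<in> R"
  by (induction A rule: infinite_finite_induct) (auto intro: zero_mem add_mem)

lemma prod_mem: "(\<And>i. i \<in> A \<Longrightarrow> f i \<in> R) \<Longrightarrow> prod f A \<in> R"
  by (induction A rule: infinite_finite_induct) (auto intro: one_mem mult_mem)

lemmas closed = zero_mem one_mem diff_mem minus_mem add_mem mult_mem power_mem numeral_mem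

definition units :: "'k set" where
  "units = {x \<in> R. x \<noteq> 0 \<and> inverse x \<in> R}"

definition multiples :: "'k \<Rightarrow> 'k set" where
  "multiples e = (\<lambda>z. e * z) ` R"

lemma unit_mem: "x \<in> units \<Longrightarrow> x \<in> R"
  by (simp add: units_def)

lemma one_unit: "1 \<in> units"
  by (simp add: units_def one_mem)

lemma unit_mult: "x \<in> units \<Longrightarrow> y \<in> units \<Longrightarrow> x * y \<in> units"
  by (auto simp: units_def mult_mem)

lemma unit_minus: "x \<in> units \<Longrightarrow> - x \<in> units"
  by (auto simp: units_def minus_mem)

lemma unit_factor: "x * y \<in> units \<Longrightarrow> x \<in> R \<Longrightarrow> y \<in> R \<Longrightarrow> x \<in> units"
proof -
  assume *: "x * y \<in> units" "x \<in> R" "y \<in> R"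
  have "inverse x = inverse (x * y) * y"
    using * by (auto simp: units_def)
  also have "\<dots> \<in> R"
    using * by (intro mult_mem) (auto simp: units_def)
  finally show ?thesis using * by (auto simp: units_def simp del: inverse_mult_distrib)
qed

lemma multiples_add: "x \<in> multiples e \<Longrightarrow> y \<in> multiples e \<Longrightarrow> x + y \<in> multiples e"
  unfolding multiples_def by (auto simp: distrib_left[symmetric] intro!: imageI add_mem)

lemma multiples_multR: "x \<in> multiples e \<Longrightarrow> y \<in> R \<Longrightarrow> x * y \<in> multiples e"
  unfolding multiples_def by (auto simp: mult.assoc intro!: imageI mult_mem)

lemma multiples_multL: "x \<in> multiples e \<Longrightarrow> y \<in> R \<Longrightarrow> y * x \<in> multiples e"
  using multiples_multR[of x e y] by (simp add: mult.commute)

lemma multiples_minus: "x \<in> multiples e \<Longrightarrow> - x \<in> multiples e"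
  using multiples_multR[of x e "-1"] by (simp add: closed)

lemma multiples_diff: "x \<in> multiples e \<Longrightarrow> y \<in> multiples e \<Longrightarrow> x - y \<in> multiples e"
  using multiples_add[OF _ multiples_minus] by force

lemma multiples_zero: "0 \<in> multiples e"
  unfolding multiples_def by (auto intro!: image_eqI[of _ _ 0] zero_mem)

lemma multiplesI: "x \<in> R \<Longrightarrow> e * x \<in> multiples e"
  by (auto simp: multiples_def)

lemma multiples_unit_cancel:
  assumes "u * x \<in> multiples e" "u \<in> units"
  shows "x \<in> multiples e"
  using multiples_multL[OF assms(1), of "inverse u"] assms(2)
  by (auto simp: units_def mult.assoc[symmetric])

lemma multiples_subset: "e \<in> R \<Longrightarrow> x \<in> multiples e \<Longrightarrow> x \<in> R"
  by (auto simp: multiples_def mult_mem)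

end

locale local_subring = field_subring R for R :: "'k::field_char_0 set" +
  assumes nonunit_add: "x \<in> R - units \<Longrightarrow> y \<in> R - units \<Longrightarrow> x + y \<in> R - units"
begin

definition maxideal :: "'k set" where "maxideal = R - units"

lemma maxideal_mem: "x \<in> maxideal \<Longrightarrow> x \<in> R"
  by (simp add: maxideal_def)

lemma maxideal_add: "x \<in> maxideal \<Longrightarrow> y \<in> maxideal \<Longrightarrow> x + y \<in> maxideal"
  using nonunit_add by (simp add: maxideal_def)

lemma maxideal_multR: "x \<in> maxideal \<Longrightarrow> y \<in> R \<Longrightarrow> x * y \<in> maxideal"
  using unit_factor by (auto simp: maxideal_def mult_mem)

lemma maxideal_multL: "x \<in> maxideal \<Longrightarrow> y \<in> R \<Longrightarrow> y * x \<in> maxideal"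
  using maxideal_multR[of x y] by (simp add: mult.commute)

lemma maxideal_minus: "x \<in> maxideal \<Longrightarrow> - x \<in> maxideal"
  using maxideal_multR[of x "-1"] by (simp add: closed)

lemma maxideal_diff: "x \<in> maxideal \<Longrightarrow> y \<in> maxideal \<Longrightarrow> x - y \<in> maxideal"
  using maxideal_add[OF _ maxideal_minus] by force

lemma maxideal_power: "x \<in> maxideal \<Longrightarrow> m > 0 \<Longrightarrow> x ^ m \<in> maxideal"
  by (cases m) (auto intro: maxideal_multR power_mem maxideal_mem)

lemma maxideal_not_unit: "x \<in> maxideal \<Longrightarrow> x \<notin> units"
  by (simp add: maxideal_def)

lemma unit_or_maxideal: "x \<in> R \<Longrightarrow> x \<in> units \<or> x \<in> maxideal"
  by (auto simp: maxideal_def)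

lemma maxideal_prime: "x * y \<in> maxideal \<Longrightarrow> x \<in> R \<Longrightarrow> y \<in> R \<Longrightarrow> x \<in> maxideal \<or> y \<in> maxideal"
  using unit_mult by (auto simp: maxideal_def)

lemma unit_add_maxideal: "x \<in> units \<Longrightarrow> y \<in> maxideal \<Longrightarrow> x + y \<in> units"
  using maxideal_diff[of "x + y" y] unit_or_maxideal[of "x + y"] maxideal_not_unit[of x]
  by (auto intro: add_mem unit_mem maxideal_mem)

lemma multiples_maxideal: "e \<in> maxideal \<Longrightarrow> x \<in> multiples e \<Longrightarrow> x \<in> maxideal"
  by (auto simp: multiples_def maxideal_multR)

end

section \<open>Existence of valuation rings\<close>

definition adjoin :: "'k::field_char_0 set \<Rightarrow> 'k \<Rightarrow> 'k set" where
  "adjoin B x = {poly p x | p. \<forall>i. coeff p i \<in> B}"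

lemma field_subring_adjoin:
  assumes "field_subring B"
  shows "field_subring (adjoin B x)"
proof -
  interpret field_subring B by fact
  show ?thesis
  proof
    show "1 \<in> adjoin B x"
      unfolding adjoin_def by (auto intro!: exI[of _ 1] simp: coeff_1 zero_mem one_mem)
    show "a - b \<in> adjoin B x" if "a \<in> adjoin B x" "b \<in> adjoin B x" for a b
      using that unfolding adjoin_def by clarify (rule_tac x = "p - pa" in exI, simp add: diff_mem)
    show "a * b \<in> adjoin B x" if "a \<in> adjoin B x" "b \<in> adjoin B x" for a b
      using that unfolding adjoin_def
      by clarify (rule_tac x = "p * pa" in exI, simp add: coeff_mult sum_mem mult_mem)
  qed
qed

lemma (in field_subring) subset_adjoin: "R \<subseteq> adjoin R x"
proof
  fix b assume "b \<in> R"
  then show "b \<in> adjoin R x"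
    unfolding adjoin_def by (intro CollectI exI[of _ "[:b:]"]) (auto simp: coeff_pCons zero_mem split: nat.split)
qed

lemma (in field_subring) mem_adjoin: "x \<in> adjoin R x"
  unfolding adjoin_def
  by (intro CollectI exI[of _ "[:0, 1:]"]) (auto simp: coeff_pCons zero_mem one_mem split: nat.split)

text \<open>
  A subring that is maximal among those avoiding \<open>v\<close> and that contains \<open>1 / v\<close>. By
  Zorn's lemma such rings exist; the lemmas below show that they are valuation rings.
\<close>
locale maximal_avoiding = field_subring B for B :: "'k::field_char_0 set" +
  fixes v :: 'k
  assumes avoids: "v \<notin> B" and inverse_mem: "inverse v \<in> B"
    and maximal: "\<And>C. field_subring C \<Longrightarrow> B \<subseteq> C \<Longrightarrow> v \<notin> C \<Longrightarrow> C = B"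
begin

lemma v_nonzero: "v \<noteq> 0"
  using avoids zero_mem by auto

text \<open>
  Allowing powers of \<open>s\<close> as denominators does not produce \<open>v\<close>: since \<open>v - b = v * s\<close>,
  an exponent can always be lowered. By maximality \<open>1 / s\<close> was already there.
\<close>
lemma one_minus_invertible:
  assumes b: "b \<in> B"
  defines "s \<equiv> 1 - inverse v * b"
  shows "s \<noteq> 0" "inverse s \<in> B"
proof -
  have s: "s \<in> B" unfolding s_def by (intro closed inverse_mem b)
  show "s \<noteq> 0"
    using avoids b v_nonzero by (auto simp: s_def field_simps)
  define C where "C = {x. \<exists>m. x * s ^ m \<in> B}"
  have "field_subring C"
  proof
    show "1 \<in> C" unfolding C_def by (auto intro!: exI[of _ 0] one_mem)
    show "x - y \<in> C" "x * y \<in> C" if xy: "x \<in> C" "y \<in> C" for x y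
    proof -
      obtain m l where ml: "x * s ^ m \<in> B" "y * s ^ l \<in> B"
        using xy unfolding C_def by blast
      have "(x - y) * s ^ (m + l) = (x * s ^ m) * s ^ l - (y * s ^ l) * s ^ m"
        by (simp add: power_add algebra_simps)
      also have "\<dots> \<in> B" by (intro closed ml s)
      finally show "x - y \<in> C" by (auto simp: C_def)
      have "(x * y) * s ^ (m + l) = (x * s ^ m) * (y * s ^ l)"
        by (simp add: power_add algebra_simps)
      also have "\<dots> \<in> B" by (intro closed ml)
      finally show "x * y \<in> C" by (auto simp: C_def)
    qed
  qed
  moreover have "B \<subseteq> C"
  proof
    fix x assume "x \<in> B"
    then show "x \<in> C" unfolding C_def by (auto intro!: exI[of _ 0])
  qed
  moreover have "v \<notin> C"
  proof
    assume "v \<in> C"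
    then obtain m where "v * s ^ m \<in> B" by (auto simp: C_def)
    then have "v \<in> B"
    proof (induction m)
      case (Suc m)
      have "v * s ^ m = v * s ^ Suc m + b * s ^ m"
        using v_nonzero by (simp add: s_def algebra_simps)
      also have "\<dots> \<in> B" by (intro closed Suc.prems b s)
      finally show ?case by (rule Suc.IH)
    qed simp
    then show False using avoids by blast
  qed
  ultimately have "C = B" by (rule maximal)
  moreover have "inverse s \<in> C"
    unfolding C_def using \<open>s \<noteq> 0\<close> one_mem by (auto intro!: exI[of _ 1])
  ultimately show "inverse s \<in> B" by simp
qed

lemma relation_if_not_mem:
  assumes "x \<notin> B"
  shows "\<exists>p. (\<forall>i. coeff p i \<in> B) \<and> poly p x = v"
proof -
  have "v \<in> adjoin B x"
    using maximal[OF field_subring_adjoin[OF field_subring_axioms] subset_adjoin, of x]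
      mem_adjoin[of x] assms by blast
  then show ?thesis by (auto simp: adjoin_def)
qed

text \<open>
  In the relation for \<open>1 / x\<close>, the constant coefficient \<open>c\<close> moves to the other side,
  where \<open>v - c = v * s\<close> with \<open>s\<close> invertible. Dividing by \<open>v * s\<close> and clearing
  denominators expresses \<open>x ^ degree p\<close> by lower powers of \<open>x\<close>, and this eliminates the
  leading term of \<open>p\<close>.
\<close>
lemma relation_lower_degree:
  assumes x: "x \<noteq> 0"
    and p: "\<And>i. coeff p i \<in> B" "poly p x = v" and q: "\<And>i. coeff q i \<in> B" "poly q (inverse x) = v"
    and deg: "degree q \<le> degree p"
  shows "\<exists>p'. (\<forall>i. coeff p' i \<in> B) \<and> poly p' x = v \<and> degree p' < degree p"
proof -
  obtain c q' where q': "q = pCons c q'" by (cases q)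
  have c: "c \<in> B" using q(1)[of 0] by (simp add: q')
  have q'B: "coeff q' i \<in> B" for i using q(1)[of "Suc i"] by (simp add: q')
  have "q' \<noteq> 0" using q(2) c avoids by (auto simp: q')
  then have dq: "degree q = Suc (degree q')" by (simp add: q')
  define m s where "m = degree p" and "s = 1 - inverse v * c"
  have s: "s \<noteq> 0" "inverse s \<in> B" using one_minus_invertible[OF c] by (simp_all add: s_def)
  have m: "m > 0" "Suc (degree q') \<le> m" using deg dq by (simp_all add: m_def)
  define r where "r = monom 1 (m - Suc (degree q')) * reflect_poly q'"
  have rB: "coeff r i \<in> B" for i
    using q'B zero_mem by (auto simp: r_def coeff_monom_mult coeff_reflect_poly)
  have deg_r: "degree r < m"
  proof -
    have "degree r \<le> (m - Suc (degree q')) + degree (reflect_poly q')"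
      unfolding r_def by (rule order.trans[OF degree_mult_le]) (simp add: degree_monom_eq)
    also have "\<dots> < m" using degree_reflect_poly_le[of q'] m by simp
    finally show ?thesis .
  qed
  have "poly r x = x ^ (m - Suc (degree q')) * (x ^ degree q' * poly q' (inverse x))"
    using x by (simp add: r_def poly_monom poly_reflect_poly_nz)
  also have "\<dots> = x ^ (m - 1) * poly q' (inverse x)"
    using m by (simp add: power_add[symmetric] mult_ac)
  also have "\<dots> = x ^ m * (inverse x * poly q' (inverse x))"
    using m x by (simp add: power_eq_if)
  also have "inverse x * poly q' (inverse x) = v - c"
    using q(2) by (simp add: q' algebra_simps)
  also have "v - c = v * s" using v_nonzero by (simp add: s_def field_simps)
  finally have r: "poly (smult (inverse s * inverse v) r) x = x ^ m"
    using s v_nonzero by (simp add: field_simps)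
  define k where "k = coeff p m"
  \<comment> \<open>The leading term \<open>k * x ^ m\<close> of \<open>p\<close> is replaced by the expression for \<open>x ^ m\<close> found above.\<close>
  define p' where "p' = (p - monom k m) + smult (k * (inverse s * inverse v)) r"
  have "poly p' x = v"
    using r by (simp add: p'_def poly_monom p(2) mult.assoc)
  moreover have "coeff p' i \<in> B" for i
    unfolding p'_def by (auto simp: k_def coeff_monom intro!: closed p rB s inverse_mem)
  moreover have "degree p' < m"
  proof -
    have "coeff (p - monom k m) i = 0" if "i > m - 1" for i
      using that m by (cases "i = m") (auto simp: k_def coeff_monom m_def coeff_eq_0)
    then have "degree (p - monom k m) \<le> m - 1" by (intro degree_le) blast
    then have "degree (p - monom k m) < m" using m by linarith
    moreover have "degree (smult (k * (inverse s * inverse v)) r) < m"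
      using deg_r degree_smult_le order.strict_trans1 by blast
    ultimately show ?thesis unfolding p'_def by (rule degree_add_less)
  qed
  ultimately show ?thesis unfolding m_def by blast
qed

text \<open>
  Of two relations of least degree, one for \<open>x\<close> and one for \<open>1 / x\<close>, the one of larger
  degree could be shortened.
\<close>
lemma mem_or_inverse_mem: "x \<in> B \<or> inverse x \<in> B"
proof (rule ccontr)
  assume *: "\<not> ?thesis"
  then have x: "x \<noteq> 0" using zero_mem by auto
  define D where "D x m \<longleftrightarrow> (\<exists>p. (\<forall>i. coeff p i \<in> B) \<and> poly p x = v \<and> degree p = m)" for x m
  have ex: "\<exists>m. D x m" "\<exists>m. D (inverse x) m"
    using relation_if_not_mem[of x] relation_if_not_mem[of "inverse x"] * by (auto simp: D_def)
  define m l where "m = (LEAST m. D x m)" and "l = (LEAST m. D (inverse x) m)"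
  obtain p where p: "\<And>i. coeff p i \<in> B" "poly p x = v" "degree p = m"
    using LeastI_ex[OF ex(1)] unfolding m_def[symmetric] by (auto simp: D_def)
  obtain q where q: "\<And>i. coeff q i \<in> B" "poly q (inverse x) = v" "degree q = l"
    using LeastI_ex[OF ex(2)] unfolding l_def[symmetric] by (auto simp: D_def)
  show False
  proof (cases "l \<le> m")
    case True
    then obtain m' where "m' < m" "D x m'"
      using relation_lower_degree[of x p q] x p q by (auto simp: D_def)
    then show False using not_less_Least unfolding m_def by blast
  next
    case False
    then obtain l' where "l' < l" "D (inverse x) l'"
      using relation_lower_degree[of "inverse x" q p] x p q by (auto simp: D_def)
    then show False using not_less_Least unfolding l_def by blast
  qed
qed

end

locale valuation_subring = field_subring R for R :: "'k::field_char_0 set" +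
  assumes mem_or_inverse: "x \<in> R \<or> inverse x \<in> R"

text \<open>
  If \<open>x / y\<close> lies in \<open>R\<close>, then \<open>x + y = y * (x / y + 1)\<close> is a unit only if
  \<open>y\<close> is one.
\<close>
sublocale valuation_subring \<subseteq> local_subring R
proof
  fix x y assume xy: "x \<in> R - units" "y \<in> R - units"
  have *: "a + b \<notin> units" if ab: "a \<in> R" "b \<in> R" "b \<notin> units" "b \<noteq> 0" "a / b \<in> R" for a b
  proof
    assume "a + b \<in> units"
    moreover have "a + b = b * (a / b + 1)" using that by (simp add: field_simps)
    ultimately show False using unit_factor[of b "a / b + 1"] that by (auto intro: closed)
  qed
  have "x + y \<notin> units"
  proof (cases "x = 0 \<or> y = 0")
    case False
    have "x / y \<in> R \<or> y / x \<in> R"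
      using mem_or_inverse[of "x / y"] by simp
    then show ?thesis using *[of x y] *[of y x] xy False by (auto simp: add.commute)
  qed (use xy in auto)
  then show "x + y \<in> R - units" using xy by (auto intro: closed)
qed

text \<open>
  Chevalley's extension theorem. If \<open>B\<close> is generated by a ring \<open>A\<close> and \<open>1 / v\<close>, the
  hypothesis \<open>v \<notin> B\<close> says that \<open>v\<close> is not integral over \<open>A\<close>; such an element is
  infinite with respect to some valuation that is finite on \<open>A\<close>.
\<close>
lemma ex_valuation_subring:
  assumes B: "field_subring (B :: 'k::field_char_0 set)" "v \<notin> B" "inverse v \<in> B"
  shows "\<exists>R. valuation_subring R \<and> B \<subseteq> R \<and> v \<notin> R"
proof -
  define S where "S = {C. field_subring C \<and> B \<subseteq> C \<and> v \<notin> C}"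
  have "\<exists>M\<in>S. \<forall>X\<in>S. M \<subseteq> X \<longrightarrow> X = M"
  proof (rule subset_Zorn_nonempty)
    show "S \<noteq> {}" using B by (auto simp: S_def)
    fix \<C> assume C: "\<C> \<noteq> {}" "subset.chain S \<C>"
    have sub: "field_subring X" "B \<subseteq> X" "v \<notin> X" if "X \<in> \<C>" for X
      using C(2) that by (auto simp: S_def subset.chain_def)
    have two: "\<exists>X\<in>\<C>. x \<in> X \<and> y \<in> X" if "x \<in> \<Union>\<C>" "y \<in> \<Union>\<C>" for x y
      using C(2) that unfolding subset.chain_def by blast
    have "field_subring (\<Union>\<C>)"
    proof
      show "1 \<in> \<Union>\<C>" using C(1) sub(1) field_subring.one_mem by blast
      show "x - y \<in> \<Union>\<C>" "x * y \<in> \<Union>\<C>" if "x \<in> \<Union>\<C>" "y \<in> \<Union>\<C>" for x y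
        using two[OF that] sub(1) field_subring.diff_mem field_subring.mult_mem by blast+
    qed
    moreover obtain X where "X \<in> \<C>" using C(1) by blast
    ultimately show "\<Union>\<C> \<in> S" unfolding S_def using sub by blast
  qed
  then obtain M where M: "M \<in> S" "\<And>X. X \<in> S \<Longrightarrow> M \<subseteq> X \<Longrightarrow> X = M" by blast
  interpret maximal_avoiding M v
    using M B(3) unfolding maximal_avoiding_def maximal_avoiding_axioms_def S_def by blast
  show ?thesis
    using M(1) mem_or_inverse_mem
    unfolding valuation_subring_def valuation_subring_axioms_def S_def by blast
qed

section \<open>A field of real sequences\<close>

definition is_ideal :: "'a::comm_ring_1 set \<Rightarrow> bool" where
  "is_ideal I \<longleftrightarrow> 0 \<in> I \<and> (\<forall>f\<in>I. \<forall>g\<in>I. f - g \<in> I) \<and> (\<forall>f\<in>I. \<forall>g. g * f \<in> I)"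

lemma idealD:
  assumes "is_ideal I"
  shows "0 \<in> I" "f \<in> I \<Longrightarrow> g \<in> I \<Longrightarrow> f - g \<in> I" "f \<in> I \<Longrightarrow> g * f \<in> I" "f \<in> I \<Longrightarrow> - f \<in> I"
    "f \<in> I \<Longrightarrow> g \<in> I \<Longrightarrow> f + g \<in> I"
proof -
  show *: "0 \<in> I" "f \<in> I \<Longrightarrow> g \<in> I \<Longrightarrow> f - g \<in> I" "f \<in> I \<Longrightarrow> g * f \<in> I" for f g
    using assms by (auto simp: is_ideal_def)
  show neg: "f \<in> I \<Longrightarrow> - f \<in> I" for f using *(1) *(2)[of 0 f] by simp
  show "f \<in> I \<Longrightarrow> g \<in> I \<Longrightarrow> f + g \<in> I" using *(2)[of f "- g"] neg by simp
qed

text \<open>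
  The last clause says that the quotient by \<open>M\<close> is a field: the ideal generated by \<open>M\<close> and
  \<open>f\<close> contains \<open>1\<close>.
\<close>
lemma ex_maximal_ideal:
  fixes I :: "'a::comm_ring_1 set"
  assumes I: "is_ideal I" "1 \<notin> I"
  shows "\<exists>M. is_ideal M \<and> I \<subseteq> M \<and> 1 \<notin> M \<and> (\<forall>f. f \<notin> M \<longrightarrow> (\<exists>g. g * f - 1 \<in> M))"
proof -
  define S where "S = {J :: 'a set. is_ideal J \<and> I \<subseteq> J \<and> 1 \<notin> J}"
  have "\<exists>M\<in>S. \<forall>X\<in>S. M \<subseteq> X \<longrightarrow> X = M"
  proof (rule subset_Zorn_nonempty)
    show "S \<noteq> {}" using I by (auto simp: S_def)
    fix \<C> assume C: "\<C> \<noteq> {}" "subset.chain S \<C>"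
    have sub: "is_ideal X" "I \<subseteq> X" "1 \<notin> X" if "X \<in> \<C>" for X
      using C(2) that by (auto simp: S_def subset.chain_def)
    have two: "\<exists>X\<in>\<C>. x \<in> X \<and> y \<in> X" if "x \<in> \<Union>\<C>" "y \<in> \<Union>\<C>" for x y
      using C(2) that unfolding subset.chain_def by blast
    have "is_ideal (\<Union>\<C>)"
      unfolding is_ideal_def
    proof (intro conjI ballI allI)
      show "0 \<in> \<Union>\<C>" using C(1) sub(1) idealD(1) by blast
      show "f - g \<in> \<Union>\<C>" if "f \<in> \<Union>\<C>" "g \<in> \<Union>\<C>" for f g
        using two[OF that] sub(1) idealD(2) by blast
      show "g * f \<in> \<Union>\<C>" if "f \<in> \<Union>\<C>" for f g
        using that sub(1) idealD(3) by blast
    qed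
    moreover obtain X where "X \<in> \<C>" using C(1) by blast
    ultimately show "\<Union>\<C> \<in> S" unfolding S_def using sub by blast
  qed
  then obtain M where MS: "M \<in> S" and max: "\<And>X. X \<in> S \<Longrightarrow> M \<subseteq> X \<Longrightarrow> X = M"
    by blast
  have M: "is_ideal M" "I \<subseteq> M" "1 \<notin> M" using MS by (simp_all add: S_def)
  have "\<exists>g. g * f - 1 \<in> M" if "f \<notin> M" for f
  proof -
    define J where "J = {m + g * f | m g. m \<in> M}"
    have MJ: "M \<subseteq> J"
    proof
      fix m assume "m \<in> M"
      then show "m \<in> J" unfolding J_def by (intro CollectI exI[of _ m] exI[of _ 0]) simp
    qed
    have fJ: "f \<in> J"
      unfolding J_def using idealD(1)[OF M(1)] by (intro CollectI exI[of _ 0] exI[of _ 1]) simp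
    have J: "is_ideal J"
      unfolding is_ideal_def
    proof (intro conjI ballI allI)
      show "0 \<in> J" using MJ idealD(1)[OF M(1)] by blast
      show "u - v \<in> J" if uv: "u \<in> J" "v \<in> J" for u v
      proof -
        obtain m g m' g' where *: "u = m + g * f" "v = m' + g' * f" "m \<in> M" "m' \<in> M"
          using uv unfolding J_def by blast
        have "u - v = (m - m') + (g - g') * f" by (simp add: * algebra_simps)
        then show ?thesis using idealD(2)[OF M(1) *(3,4)] unfolding J_def by blast
      qed
      show "h * u \<in> J" if u: "u \<in> J" for u h
      proof -
        obtain m g where *: "u = m + g * f" "m \<in> M"
          using u unfolding J_def by blast
        have "h * u = h * m + (h * g) * f" by (simp add: * algebra_simps)
        then show ?thesis using idealD(3)[OF M(1) *(2)] unfolding J_def by blast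
      qed
    qed
    have "1 \<in> J"
      using max[of J] J MJ M fJ that by (auto simp: S_def)
    then obtain m g where mg: "1 = m + g * f" "m \<in> M" unfolding J_def by blast
    have "g * f - 1 = - m" unfolding mg(1) by simp
    then show ?thesis using idealD(4)[OF M(1) mg(2)] by metis
  qed
  then show ?thesis using M by blast
qed

text \<open>
  Finitely supported sequences are included so that two sequences with the same class agree at
  infinitely many indices.
\<close>
definition null_seqs :: "(nat \<Rightarrow> real) set" where
  "null_seqs = (SOME M. is_ideal M \<and> {f. finite {m. f m \<noteq> 0}} \<subseteq> M \<and> 1 \<notin> M \<and>
     (\<forall>f. f \<notin> M \<longrightarrow> (\<exists>g. g * f - 1 \<in> M)))"

lemma null_seqs:
  shows null_seqs_ideal: "is_ideal null_seqs"
    and finite_support_null: "finite {m. f m \<noteq> 0} \<Longrightarrow> f \<in> null_seqs"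
    and one_not_null: "1 \<notin> null_seqs"
    and invertible_mod_null: "f \<notin> null_seqs \<Longrightarrow> \<exists>g. g * f - 1 \<in> null_seqs"
proof -
  let ?I = "{f :: nat \<Rightarrow> real. finite {m. f m \<noteq> 0}}"
  have "is_ideal ?I"
    unfolding is_ideal_def
  proof (intro conjI ballI allI)
    show "f - g \<in> ?I" if "f \<in> ?I" "g \<in> ?I" for f g
    proof -
      have "{m. (f - g) m \<noteq> 0} \<subseteq> {m. f m \<noteq> 0} \<union> {m. g m \<noteq> 0}" by auto
      then show ?thesis using that by (auto intro: finite_subset)
    qed
    show "g * f \<in> ?I" if "f \<in> ?I" for f g
    proof -
      have "{m. (g * f) m \<noteq> 0} \<subseteq> {m. f m \<noteq> 0}" by auto
      then show ?thesis using that by (auto intro: finite_subset)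
    qed
  qed simp
  moreover have "1 \<notin> ?I" by simp
  ultimately have "is_ideal null_seqs \<and> ?I \<subseteq> null_seqs \<and> 1 \<notin> null_seqs \<and>
     (\<forall>f. f \<notin> null_seqs \<longrightarrow> (\<exists>g. g * f - 1 \<in> null_seqs))"
    unfolding null_seqs_def by (intro someI_ex[where P = "\<lambda>M. is_ideal M \<and> ?I \<subseteq> M \<and> 1 \<notin> M \<and>
     (\<forall>f. f \<notin> M \<longrightarrow> (\<exists>g. g * f - 1 \<in> M))"] ex_maximal_ideal)
  then show "is_ideal null_seqs" "finite {m. f m \<noteq> 0} \<Longrightarrow> f \<in> null_seqs" "1 \<notin> null_seqs"
    "f \<notin> null_seqs \<Longrightarrow> \<exists>g. g * f - 1 \<in> null_seqs"
    by blast+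
qed

lemmas null_closed = idealD[OF null_seqs_ideal]

lemma zero_null: "(\<And>m. f m = 0) \<Longrightarrow> f \<in> null_seqs"
  by (rule finite_support_null) simp

text \<open>
  A sequence with only finitely many zeros becomes invertible after adding a finitely supported one.
\<close>
lemma null_vanishes_infinitely_often:
  assumes "f \<in> null_seqs"
  shows "infinite {m. f m = 0}"
proof
  assume fin: "finite {m. f m = 0}"
  define g h :: "nat \<Rightarrow> real" where "g m = inverse (f m)" and "h m = (if f m = 0 then 1 else 0)" for m
  have "g * f + h = 1" by (auto simp: g_def h_def)
  moreover have "h \<in> null_seqs" using fin by (intro finite_support_null) (simp add: h_def)
  then have "g * f + h \<in> null_seqs" using assms by (intro null_closed)
  ultimately show False using one_not_null by simp
qed

text \<open>
  The quotient of the ring of sequences by a maximal ideal is an ultrapower of the reals. Only its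
  field structure matters here, and for this the ideal is more convenient than the ultrafilter that
  corresponds to it.
\<close>
quotient_type ultrareal = "nat \<Rightarrow> real" / "\<lambda>f g. f - g \<in> null_seqs"
proof (rule equivpI)
  show "reflp (\<lambda>f g. f - g \<in> null_seqs)" by (simp add: reflp_def null_closed(1))
  show "symp (\<lambda>f g. f - g \<in> null_seqs)"
    unfolding symp_def using null_closed(4) by (metis minus_diff_eq)
  show "transp (\<lambda>f g. f - g \<in> null_seqs)"
  proof (rule transpI)
    fix f g h assume "f - g \<in> null_seqs" "g - h \<in> null_seqs"
    from null_closed(5)[OF this] show "f - h \<in> null_seqs" by simp
  qed
qed

lift_definition ultra :: "(nat \<Rightarrow> real) \<Rightarrow> ultrareal" is "\<lambda>f. f" .

instantiation ultrareal :: field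
begin

lift_definition zero_ultrareal :: ultrareal is 0 .
lift_definition one_ultrareal :: ultrareal is 1 .
lift_definition plus_ultrareal :: "ultrareal \<Rightarrow> ultrareal \<Rightarrow> ultrareal" is "(+)"
  using null_closed(5) by (simp add: add_diff_add)
lift_definition uminus_ultrareal :: "ultrareal \<Rightarrow> ultrareal" is uminus
proof -
  fix f g :: "nat \<Rightarrow> real" assume "f - g \<in> null_seqs"
  from null_closed(4)[OF this] show "- f - - g \<in> null_seqs" by simp
qed
lift_definition minus_ultrareal :: "ultrareal \<Rightarrow> ultrareal \<Rightarrow> ultrareal" is "(-)"
proof -
  fix f g h k :: "nat \<Rightarrow> real" assume "f - g \<in> null_seqs" "h - k \<in> null_seqs"
  from null_closed(2)[OF this] show "f - h - (g - k) \<in> null_seqs" by (simp add: algebra_simps)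
qed
lift_definition times_ultrareal :: "ultrareal \<Rightarrow> ultrareal \<Rightarrow> ultrareal" is "(*)"
proof -
  fix f g h k :: "nat \<Rightarrow> real" assume "f - g \<in> null_seqs" "h - k \<in> null_seqs"
  then have "h * (f - g) + g * (h - k) \<in> null_seqs" using null_closed(3,5) by blast
  then show "f * h - g * k \<in> null_seqs" by (simp add: algebra_simps)
qed

definition inverse_ultrareal :: "ultrareal \<Rightarrow> ultrareal" where
  "inverse_ultrareal x = (if x = 0 then 0 else (SOME y. y * x = 1))"

definition divide_ultrareal :: "ultrareal \<Rightarrow> ultrareal \<Rightarrow> ultrareal" where
  "divide_ultrareal x y = x * inverse y"

instance
proof
  fix a b c :: ultrareal
  show "a + b + c = a + (b + c)" by transfer (simp add: null_closed(1) algebra_simps)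
  show "a + b = b + a" by transfer (simp add: null_closed(1) algebra_simps)
  show "0 + a = a" by transfer (simp add: null_closed(1))
  show "- a + a = 0" by transfer (simp add: null_closed(1))
  show "a - b = a + - b" by transfer (simp add: null_closed(1))
  show "a * b * c = a * (b * c)" by transfer (simp add: null_closed(1) algebra_simps)
  show "a * b = b * a" by transfer (simp add: null_closed(1) algebra_simps)
  show "1 * a = a" by transfer (simp add: null_closed(1))
  show "(a + b) * c = a * c + b * c" by transfer (simp add: null_closed(1) algebra_simps)
  show "(0 :: ultrareal) \<noteq> 1" by transfer (use one_not_null null_closed(4)[of "- 1"] in auto)
  show "inverse a * a = 1" if "a \<noteq> 0"
  proof -
    have "\<exists>y. y * a = 1" using that
    proof transfer
      fix f :: "nat \<Rightarrow> real" assume "\<not> f - 0 \<in> null_seqs"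
      then have "f \<notin> null_seqs" by simp
      then show "\<exists>g. g * f - 1 \<in> null_seqs" by (rule invertible_mod_null)
    qed
    then show ?thesis using that by (simp add: inverse_ultrareal_def) (rule someI_ex)
  qed
  show "a div b = a * inverse b" by (rule divide_ultrareal_def)
  show "inverse (0 :: ultrareal) = 0" by (simp add: inverse_ultrareal_def)
qed

end

lemma ultra_zero: "ultra (\<lambda>_. 0) = 0" by transfer (rule zero_null, simp)
lemma ultra_one: "ultra (\<lambda>_. 1) = 1" by transfer (rule zero_null, simp)

lemma ultra_add: "ultra (\<lambda>m. f m + g m) = ultra f + ultra g"
  by transfer (rule zero_null, simp)

lemma ultra_diff: "ultra (\<lambda>m. f m - g m) = ultra f - ultra g"
  by transfer (rule zero_null, simp)

lemma ultra_minus: "ultra (\<lambda>m. - f m) = - ultra f"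
  by transfer (rule zero_null, simp)

lemma ultra_mult: "ultra (\<lambda>m. f m * g m) = ultra f * ultra g"
  by transfer (rule zero_null, simp)

lemma ultra_eq_infinitely_often: "ultra f = ultra g \<Longrightarrow> infinite {m. f m = g m}"
  using null_vanishes_infinitely_often[of "f - g"] by transfer simp

lemma ultra_power: "ultra (\<lambda>m. f m ^ k) = ultra f ^ k"
  by (induction k) (simp_all add: ultra_one ultra_mult)

lemma ultra_sum: "ultra (\<lambda>m. \<Sum>i\<in>A. f i m) = (\<Sum>i\<in>A. ultra (f i))"
  by (induction A rule: infinite_finite_induct) (simp_all add: ultra_zero ultra_add)

lemma ultra_prod: "ultra (\<lambda>m. \<Prod>i\<in>A. f i m) = (\<Prod>i\<in>A. ultra (f i))"
  by (induction A rule: infinite_finite_induct) (simp_all add: ultra_one ultra_mult)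

lemma ultra_of_nat: "ultra (\<lambda>_. of_nat k) = of_nat k"
  by (induction k) (simp_all add: ultra_zero ultra_one ultra_add)

lemma ultra_of_int: "ultra (\<lambda>_. of_int k) = of_int k"
  by (cases k) (simp_all add: ultra_of_nat ultra_minus ultra_diff ultra_one del: of_nat_Suc)

instance ultrareal :: field_char_0
proof
  show "inj (of_nat :: nat \<Rightarrow> ultrareal)"
  proof (rule injI)
    fix k l assume "of_nat k = (of_nat l :: ultrareal)"
    then have "ultra (\<lambda>_. of_nat k) = ultra (\<lambda>_. of_nat l)" by (simp add: ultra_of_nat)
    from not_finite_existsD[OF ultra_eq_infinitely_often[OF this]] show "k = l" by simp
  qed
qed

lemma ultra_numeral: "ultra (\<lambda>_. numeral w) = numeral w"
  using ultra_of_nat[of "numeral w"] by simp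

lemma ultra_inverse: "(\<And>m. f m \<noteq> 0) \<Longrightarrow> ultra (\<lambda>m. inverse (f m)) = inverse (ultra f)"
  using ultra_mult[of "\<lambda>m. inverse (f m)" f] by (intro inverse_unique[symmetric]) (simp add: ultra_one mult.commute)

section \<open>Distances with nearly degenerate triangles\<close>

text \<open>
  Heron's formula: sixteen times the squared area of a triangle whose squared side lengths are
  \<open>x\<close>, \<open>y\<close>, \<open>z\<close>.
\<close>
definition heron :: "'k::comm_ring_1 \<Rightarrow> 'k \<Rightarrow> 'k \<Rightarrow> 'k" where
  "heron x y z = 4 * x * y - (x + y - z)\<^sup>2"

lemma card_insert_le_Suc: "card (insert x A) \<le> Suc (card A)"
  by (cases "finite A") (auto simp: card_insert_if)

text \<open>
  Squared distances, rescaled so that the longest edge \<open>a b\<close> has length one. All triangles are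
  degenerate modulo the nonunit \<open>e\<close>, but only to first order in \<open>e\<close>: the cofactors
  \<open>u\<close> are units because areas are nonzero, and this prevents three points from forming a cluster.
\<close>
locale thin_distances = local_subring R for R :: "'k::field_char_0 set" +
  fixes N :: "'i set" and y :: "'i \<Rightarrow> 'i \<Rightarrow> 'k" and e :: 'k and a b :: 'i
  assumes half: "1 / 2 \<in> R" and third: "1 / 3 \<in> R"
    and N: "finite N" "card N \<ge> 5" and aN: "a \<in> N" and bN: "b \<in> N"
    and y_ab: "y a b = 1"
    and y_mem: "i \<in> N \<Longrightarrow> j \<in> N \<Longrightarrow> y i j \<in> R"
    and y_sym: "i \<in> N \<Longrightarrow> j \<in> N \<Longrightarrow> y i j = y j i"
    and y_self: "i \<in> N \<Longrightarrow> y i i = 0"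
    and e_max: "e \<in> maxideal" and e_nz: "e \<noteq> 0"
    and heron_y: "i \<in> N \<Longrightarrow> j \<in> N \<Longrightarrow> k \<in> N \<Longrightarrow> distinct [i, j, k] \<Longrightarrow>
           \<exists>u\<in>units. heron (y i k) (y j k) (y i j) = e * u"
begin

text \<open>
  In Euclidean space this is the coordinate of the orthogonal projection to the line \<open>a b\<close>,
  with \<open>a\<close> at \<open>0\<close> and \<open>b\<close> at \<open>1\<close>.
\<close>
definition pos :: "'i \<Rightarrow> 'k" where
  "pos i = (y a i + 1 - y b i) / 2"

text \<open>
  The deviation of \<open>y i j\<close> from a distance on the line. Modulo \<open>e\<close> it is the inner product
  of the components of \<open>i\<close> and \<open>j\<close> orthogonal to that line, because these components have
  squared length \<open>0\<close> modulo \<open>e\<close>.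
\<close>
definition defect :: "'i \<Rightarrow> 'i \<Rightarrow> 'k" where
  "defect i j = ((pos i - pos j)\<^sup>2 - y i j) / 2"

definition small :: "'i \<Rightarrow> 'i \<Rightarrow> bool" where
  "small i j \<longleftrightarrow> defect i j \<in> multiples e"

definition between :: "'i \<Rightarrow> bool" where
  "between i \<longleftrightarrow> pos i \<in> units \<and> 1 - pos i \<in> units"

lemma two_unit: "2 \<in> units" and three_unit: "3 \<in> units"
  using half third numeral_mem by (auto simp: units_def inverse_eq_divide)

lemma a_neq_b: "a \<noteq> b"
  using y_ab y_self aN by auto

lemma y_eq: "y i j = (pos i - pos j)\<^sup>2 - 2 * defect i j"
  by (simp add: defect_def field_simps)

lemma halve_mem: "x \<in> R \<Longrightarrow> x / 2 \<in> R"
  using mult_mem[OF half] by force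

lemma pos_mem: "i \<in> N \<Longrightarrow> pos i \<in> R"
  unfolding pos_def by (intro halve_mem closed y_mem aN bN)

lemma defect_mem: "i \<in> N \<Longrightarrow> j \<in> N \<Longrightarrow> defect i j \<in> R"
  unfolding defect_def by (intro halve_mem closed y_mem pos_mem)

lemma pos_a: "pos a = 0"
  using y_self[OF aN] y_sym[OF aN bN] y_ab by (simp add: pos_def)

lemma pos_b: "pos b = 1"
  using y_self[OF bN] y_ab by (simp add: pos_def)

lemma defect_sym: "i \<in> N \<Longrightarrow> j \<in> N \<Longrightarrow> defect i j = defect j i"
  unfolding defect_def by (simp add: y_sym power2_commute)

lemma small_sym: "i \<in> N \<Longrightarrow> j \<in> N \<Longrightarrow> small i j \<longleftrightarrow> small j i"
  by (simp add: small_def defect_sym)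

lemma small_self: "i \<in> N \<Longrightarrow> small i i"
  by (simp add: small_def defect_def y_self multiples_zero)

lemma heron_multiple:
  assumes "i \<in> N" "j \<in> N" "k \<in> N" "distinct [i, j, k]"
  shows "heron (y i k) (y j k) (y i j) \<in> multiples e"
proof -
  obtain u where "u \<in> units" "heron (y i k) (y j k) (y i j) = e * u"
    using heron_y[OF assms] by blast
  then show ?thesis using multiplesI[OF unit_mem] by simp
qed

text \<open>
  The Heron expression of the triangle \<open>a b i\<close> is \<open>-8\<close> times the defect.
\<close>
lemma small_a: "i \<in> N \<Longrightarrow> small i a"
proof -
  assume i: "i \<in> N"
  consider "i = a" | "i = b" | "distinct [i, b, a]" using a_neq_b by auto
  then show ?thesis
  proof cases
    case 3
    have "2 * pos i = y a i + 1 - y b i" by (simp add: pos_def)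
    moreover have "y a i = (pos i)\<^sup>2 - 2 * defect i a"
      using y_eq[of i a] by (simp add: pos_a y_sym[OF i aN])
    ultimately have "heron (y i a) (y b a) (y i b) = - (2 * (2 * (2 * defect i a)))"
      using y_ab y_sym[OF i aN] y_sym[OF i bN] y_sym[OF bN aN]
      by (simp add: heron_def) algebra
    then have "2 * (2 * (2 * defect i a)) \<in> multiples e"
      using multiples_minus[OF heron_multiple[OF i bN aN 3]] by simp
    then show ?thesis
      using multiples_unit_cancel[OF _ two_unit] by (simp add: small_def)
  next
    case 1
    then show ?thesis using small_self[OF aN] by simp
  next
    case 2
    then show ?thesis using y_sym[OF aN bN] y_ab
      by (simp add: small_def defect_def pos_a pos_b multiples_zero)
  qed
qed

lemma small_b: "i \<in> N \<Longrightarrow> small i b"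
proof -
  assume i: "i \<in> N"
  have "2 * pos i = y a i + 1 - y b i" by (simp add: pos_def)
  then have "defect i b = defect i a"
    using y_sym[OF i aN] y_sym[OF i bN] by (simp add: defect_def pos_a pos_b) algebra
  then show ?thesis using small_a[OF i] by (simp add: small_def)
qed

text \<open>
  If \<open>i k\<close> and \<open>j k\<close> have lengths \<open>p\<close> and \<open>q\<close>, then in a degenerate
  triangle the third side has length \<open>p - q\<close> or \<open>p + q\<close>. In terms of the defect, these are the
  two roots \<open>0\<close> and \<open>-2 * p * q\<close>.
\<close>
lemma defect_quadratic:
  assumes N: "i \<in> N" "j \<in> N" "k \<in> N" "distinct [i, j, k]" and s: "small i k" "small j k"
  shows "defect i j * (defect i j + 2 * ((pos i - pos k) * (pos j - pos k))) \<in> multiples e"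
proof -
  define p q u v h where "p = pos i - pos k" and "q = pos j - pos k"
    and "u = defect i k" and "v = defect j k" and "h = defect i j"
  have mem: "p \<in> R" "q \<in> R" "u \<in> R" "v \<in> R" "h \<in> R"
    using N by (auto simp: p_def q_def u_def v_def h_def intro!: diff_mem pos_mem defect_mem)
  have uv: "u \<in> multiples e" "v \<in> multiples e"
    using s by (auto simp: small_def u_def v_def)
  have y: "y i k = p\<^sup>2 - 2 * u" "y j k = q\<^sup>2 - 2 * v" "y i j = (p - q)\<^sup>2 - 2 * h"
    by (simp_all add: y_eq p_def q_def u_def v_def h_def)
  have "2 * (2 * (h * (h + 2 * (p * q)))) = - heron (y i k) (y j k) (y i j)
      + u * (8 * p * q - 8 * q\<^sup>2 + 8 * v - 4 * u + 8 * h) + v * (8 * p * q - 8 * p\<^sup>2 - 4 * v + 8 * h)"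
    unfolding y heron_def by algebra
  also have "\<dots> \<in> multiples e"
    by (intro multiples_add multiples_minus heron_multiple N multiples_multR uv closed mem)
  finally show ?thesis
    using multiples_unit_cancel[OF _ two_unit] by (simp add: h_def p_def q_def)
qed

text \<open>
  The two factors differ by a unit, hence in a local ring one of them is a unit.
\<close>
lemma root_dichotomy:
  assumes h: "h * (h + 2 * m) \<in> multiples e" "h \<in> R" and m: "m \<in> units"
  shows "h \<in> multiples e \<or> h + 2 * m \<in> multiples e"
proof -
  have mem: "h + 2 * m \<in> R" using h(2) unit_mem[OF m] by (intro closed)
  have "h \<in> units \<or> h + 2 * m \<in> units"
  proof (rule ccontr)
    assume "\<not> ?thesis"
    then have "h \<in> maxideal" "h + 2 * m \<in> maxideal"
      using unit_or_maxideal h(2) mem by auto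
    then have "(h + 2 * m) - h \<in> maxideal" by (intro maxideal_diff)
    then show False
      using maxideal_not_unit unit_mult[OF two_unit m] by auto
  qed
  then show ?thesis
    using h(1) multiples_unit_cancel mult.commute by metis
qed

lemma defect_quadratic_a:
  assumes "i \<in> N" "j \<in> N"
  shows "defect i j * (defect i j + 2 * (pos i * pos j)) \<in> multiples e"
proof (cases "distinct [i, j, a]")
  case True
  then show ?thesis
    using defect_quadratic[OF assms aN True small_a small_a] assms by (simp add: pos_a)
next
  case False
  then have "small i j"
    using small_a[of i] small_a[of j] small_self small_sym assms aN by auto
  then show ?thesis unfolding small_def
    by (intro multiples_multR closed defect_mem pos_mem assms)
qed

lemma defect_quadratic_b:
  assumes "i \<in> N" "j \<in> N"
  shows "defect i j * (defect i j + 2 * ((1 - pos i) * (1 - pos j))) \<in> multiples e"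
proof (cases "distinct [i, j, b]")
  case True
  have "(pos i - 1) * (pos j - 1) = (1 - pos i) * (1 - pos j)" by algebra
  then show ?thesis
    using defect_quadratic[OF assms bN True small_b small_b] assms by (simp add: pos_b)
next
  case False
  then have "small i j"
    using small_b[of i] small_b[of j] small_self small_sym assms bN by auto
  then show ?thesis unfolding small_def
    by (intro multiples_multR closed defect_mem pos_mem assms)
qed

text \<open>
  The Heron expression of the triangle would be \<open>e\<close> times a nonunit.
\<close>
lemma no_three_clustered:
  assumes N: "i \<in> N" "j \<in> N" "k \<in> N" "distinct [i, j, k]"
    and s: "small i k" "small j k" "small i j"
    and p: "pos i - pos k \<in> maxideal" "pos j - pos k \<in> maxideal"
  shows False
proof -
  define p q u v h where "p = pos i - pos k" and "q = pos j - pos k"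
    and "u = defect i k" and "v = defect j k" and "h = defect i j"
  obtain u' v' h' where z: "u' \<in> R" "u = e * u'" "v' \<in> R" "v = e * v'" "h' \<in> R" "h = e * h'"
    using s unfolding small_def multiples_def u_def v_def h_def by blast
  have pq: "p \<in> maxideal" "q \<in> maxideal" using p by (simp_all add: p_def q_def)
  have e: "e \<in> R" using e_max by (rule maxideal_mem)
  have y: "y i k = p\<^sup>2 - 2 * u" "y j k = q\<^sup>2 - 2 * v" "y i j = (p - q)\<^sup>2 - 2 * h"
    by (simp_all add: y_eq p_def q_def u_def v_def h_def)
  obtain w where w: "w \<in> units" "heron (y i k) (y j k) (y i j) = e * w"
    using heron_y[OF N] by blast
  have "e * w = e * (p * (8 * q * (u' + v' - h') - 8 * p * v') - q * (8 * q * u')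
      + e * (16 * u' * v' - 4 * (h' - u' - v')\<^sup>2))"
    unfolding w(2)[symmetric] y heron_def z by algebra
  then have "w = p * (8 * q * (u' + v' - h') - 8 * p * v') - q * (8 * q * u')
      + e * (16 * u' * v' - 4 * (h' - u' - v')\<^sup>2)"
    using e_nz by simp
  also have "\<dots> \<in> maxideal"
    by (intro maxideal_add maxideal_diff maxideal_multR pq e_max closed z maxideal_mem[OF pq(1)]
        maxideal_mem[OF pq(2)])
  finally show False using w(1) maxideal_not_unit by blast
qed

lemma not_both_ends: "pos i \<in> maxideal \<Longrightarrow> 1 - pos i \<in> maxideal \<Longrightarrow> False"
  using maxideal_add[of "pos i" "1 - pos i"] maxideal_not_unit one_unit by auto

text \<open>
  The quadratic relations for the defect with respect to \<open>a\<close> and to \<open>b\<close> have only the root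
  \<open>0\<close> in common, unless \<open>pos i * pos j\<close> and \<open>(1 - pos i) * (1 - pos j)\<close> agree modulo
  \<open>e\<close>, which means \<open>pos i + pos j = 1\<close>, or both are nonunits.
\<close>
lemma not_small_cases:
  assumes N: "i \<in> N" "j \<in> N" and big: "\<not> small i j"
  obtains (between) "between i" "between j" "pos i + pos j - 1 \<in> multiples e"
      "defect i j + 2 * (pos i * pos j) \<in> multiples e"
    | (ends) "pos i \<in> maxideal" "1 - pos j \<in> maxideal"
    | (ends') "1 - pos i \<in> maxideal" "pos j \<in> maxideal"
proof -
  define h m m' where "h = defect i j" and "m = pos i * pos j" and "m' = (1 - pos i) * (1 - pos j)"
  have mem: "h \<in> R" "m \<in> R" "m' \<in> R" "pos i \<in> R" "pos j \<in> R" "1 - pos i \<in> R" "1 - pos j \<in> R"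
    using N by (auto simp: h_def m_def m'_def intro!: closed defect_mem pos_mem)
  have h: "h * (h + 2 * m) \<in> multiples e" "h * (h + 2 * m') \<in> multiples e"
    using defect_quadratic_a[OF N] defect_quadratic_b[OF N] by (simp_all add: h_def m_def m'_def)
  have nh: "h \<notin> multiples e" using big by (simp add: small_def h_def)
  consider "m \<in> units" | "m \<in> maxideal" "m' \<in> units" | "m \<in> maxideal" "m' \<in> maxideal"
    using unit_or_maxideal mem by blast
  then show thesis
  proof cases
    case 1
    have hm: "h + 2 * m \<in> multiples e" using root_dichotomy[OF h(1) mem(1) 1] nh by blast
    have "h + 2 * m - 2 * m \<in> units"
      using unit_add_maxideal[OF unit_minus[OF unit_mult[OF two_unit 1]] multiples_maxideal[OF e_max hm]]
      by simp
    then have "h \<in> units" by simp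
    then have hm': "h + 2 * m' \<in> multiples e"
      using h(2) multiples_unit_cancel by blast
    have "2 * (pos i + pos j - 1) = (h + 2 * m) - (h + 2 * m')"
      unfolding m_def m'_def by algebra
    then have s: "pos i + pos j - 1 \<in> multiples e"
      using multiples_diff[OF hm hm'] multiples_unit_cancel[OF _ two_unit] by metis
    have "m' = m + - (pos i + pos j - 1)" unfolding m_def m'_def by algebra
    then have "m' \<in> units"
      using unit_add_maxideal[OF 1 multiples_maxideal[OF e_max multiples_minus[OF s]]] by simp
    then have "between i" "between j"
      using 1 unit_factor[of "pos i" "pos j"] unit_factor[of "pos j" "pos i"]
        unit_factor[of "1 - pos i" "1 - pos j"] unit_factor[of "1 - pos j" "1 - pos i"] mem
      by (auto simp: between_def m_def m'_def mult.commute)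
    then show thesis using between s hm by (simp add: h_def m_def)
  next
    case 2
    have hm: "h + 2 * m' \<in> multiples e" using root_dichotomy[OF h(2) mem(1) 2(2)] nh by blast
    have "h * (h + 2 * m) \<in> maxideal" by (rule multiples_maxideal[OF e_max h(1)])
    then have "h \<in> maxideal \<or> h + 2 * m \<in> maxideal"
      by (intro maxideal_prime closed mem)
    then have "h \<in> maxideal"
      using maxideal_diff[of "h + 2 * m" "2 * m"] maxideal_multL[OF 2(1) numeral_mem] by auto
    then have "h + 2 * m' - h \<in> maxideal"
      using multiples_maxideal[OF e_max hm] by (intro maxideal_diff)
    then show thesis using maxideal_not_unit unit_mult[OF two_unit 2(2)] by auto
  next
    case 3
    then have "pos i \<in> maxideal \<or> pos j \<in> maxideal" "1 - pos i \<in> maxideal \<or> 1 - pos j \<in> maxideal"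
      using maxideal_prime mem by (auto simp: m_def m'_def)
    then show thesis using ends ends' not_both_ends by blast
  qed
qed

text \<open>
  Each of the clusters around \<open>a\<close> and \<open>b\<close> contains at most one further point, because
  within a cluster all pairs are small. Four points are fewer than \<open>card N\<close>.
\<close>
lemma ex_between: "\<exists>k\<in>N. between k"
proof (rule ccontr)
  assume no: "\<not> ?thesis"
  define A B where "A = {i \<in> N. pos i \<in> maxideal}" and "B = {i \<in> N. 1 - pos i \<in> maxideal}"
  have "N \<subseteq> A \<union> B"
    using no unit_or_maxideal closed(3)[OF one_mem pos_mem] pos_mem
    by (auto simp: A_def B_def between_def)
  have A: "card (A - {a}) \<le> Suc 0"
  proof (subst card_le_Suc0_iff_eq)
    show "finite (A - {a})" using N(1) by (simp add: A_def)
    show "\<forall>i\<in>A - {a}. \<forall>j\<in>A - {a}. i = j"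
    proof (intro ballI, rule ccontr)
      fix i j assume ij: "i \<in> A - {a}" "j \<in> A - {a}" "i \<noteq> j"
      then have "small i j" 
        using not_small_cases[of i j] not_both_ends
        by (auto simp: A_def between_def maxideal_def)
      then show False
        using no_three_clustered[of i j a] ij aN small_a by (auto simp: A_def pos_a)
    qed
  qed
  have B: "card (B - {b}) \<le> Suc 0"
  proof (subst card_le_Suc0_iff_eq)
    show "finite (B - {b})" using N(1) by (simp add: B_def)
    show "\<forall>i\<in>B - {b}. \<forall>j\<in>B - {b}. i = j"
    proof (intro ballI, rule ccontr)
      fix i j assume ij: "i \<in> B - {b}" "j \<in> B - {b}" "i \<noteq> j"
      then have "small i j" 
        using not_small_cases[of i j] not_both_ends
        by (auto simp: B_def between_def maxideal_def)
      moreover have "pos i - 1 \<in> maxideal" "pos j - 1 \<in> maxideal"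
        using ij maxideal_minus[of "1 - pos i"] maxideal_minus[of "1 - pos j"] by (auto simp: B_def)
      ultimately show False
        using no_three_clustered[of i j b] ij bN small_b by (auto simp: B_def pos_b)
    qed
  qed
  have "N \<subseteq> insert a (A - {a}) \<union> insert b (B - {b})" using \<open>N \<subseteq> A \<union> B\<close> by blast
  then have "card N \<le> card (insert a (A - {a}) \<union> insert b (B - {b}))"
    using N(1) by (intro card_mono) (auto simp: A_def B_def)
  also have "\<dots> \<le> card (insert a (A - {a})) + card (insert b (B - {b}))" by (rule card_Un_le)
  also have "\<dots> \<le> Suc (card (A - {a})) + Suc (card (B - {b}))"
    by (intro add_mono card_insert_le_Suc)
  also have "\<dots> \<le> 4" using A B by simp
  finally show False using N(2) by simp
qed

text \<open>
  A point \<open>k\<close> strictly between the ends is needed: with respect to \<open>k\<close> the nonzero root is a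
  unit, while the relations with respect to \<open>a\<close> and \<open>b\<close> force the defect to be a
  nonunit.
\<close>
lemma defect_across_ends:
  assumes N: "i \<in> N" "j \<in> N" and p: "pos i \<in> maxideal" "1 - pos j \<in> maxideal"
  shows "small i j"
proof -
  obtain k where k: "k \<in> N" "between k" using ex_between by blast
  have ik: "small i k" and jk: "small j k"
    using not_small_cases[OF N(1) k(1)] not_small_cases[OF N(2) k(1)] p k(2) not_both_ends
    by (auto simp: between_def maxideal_def)
  have d: "distinct [i, j, k]"
    using p k(2) not_both_ends by (auto simp: between_def maxideal_def)
  have 1: "pos i - pos k \<in> units"
    using unit_add_maxideal[OF unit_minus p(1), of "pos k"] k(2) by (simp add: between_def)
  have 2: "pos j - pos k \<in> units"
    using unit_add_maxideal[OF _ maxideal_minus[OF p(2)], of "1 - pos k"] k(2) by (simp add: between_def)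
  have mem: "defect i j \<in> R" "pos i * pos j \<in> R" using N by (auto intro: defect_mem pos_mem mult_mem)
  have "defect i j * (defect i j + 2 * (pos i * pos j)) \<in> maxideal"
    using defect_quadratic_a[OF N] multiples_maxideal[OF e_max] by blast
  then have "defect i j \<in> maxideal \<or> defect i j + 2 * (pos i * pos j) \<in> maxideal"
    by (intro maxideal_prime closed mem)
  moreover have "2 * (pos i * pos j) \<in> maxideal"
    using p N by (intro maxideal_multL maxideal_multR closed pos_mem)
  ultimately have h: "defect i j \<in> maxideal"
    using maxideal_diff[of "defect i j + 2 * (pos i * pos j)" "2 * (pos i * pos j)"] by auto
  have "defect i j \<in> multiples e \<or> defect i j + 2 * ((pos i - pos k) * (pos j - pos k)) \<in> multiples e"
    by (intro root_dichotomy defect_quadratic N k d ik jk mem unit_mult 1 2)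
  moreover have "defect i j + 2 * ((pos i - pos k) * (pos j - pos k)) \<in> units"
    using unit_add_maxideal[OF unit_mult[OF two_unit unit_mult[OF 1 2]] h] by (simp add: add.commute)
  ultimately show ?thesis
    using multiples_maxideal[OF e_max] maxideal_not_unit by (auto simp: small_def)
qed

text \<open>
  A pair that is not small is one that takes the root \<open>-2 * pos i * pos j\<close>. Its projection to
  the line \<open>a b\<close> is symmetric about the midpoint of \<open>a b\<close>, and by \<open>big_pair_y\<close> its
  length is that of \<open>a b\<close>: modulo \<open>e\<close>, it is the edge opposite to \<open>a b\<close> in a
  tetrahedron with equal opposite edges.
\<close>
lemma big_pair:
  assumes N: "i \<in> N" "j \<in> N" and big: "\<not> small i j"
  shows "between i" "between j" "pos i + pos j - 1 \<in> multiples e"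
    "defect i j + 2 * (pos i * pos j) \<in> multiples e"
  using not_small_cases[OF N big] defect_across_ends N big small_sym by metis+

text \<open>
  With respect to \<open>k\<close>, the nonzero root for the pair \<open>c d\<close> is
  \<open>-2 * (pos c - pos k) * (pos d - pos k)\<close>. It agrees with \<open>-2 * pos c * pos d\<close> only if
  \<open>pos k * (1 - pos k) = 0\<close>, because \<open>pos c + pos d = 1\<close>.
\<close>
lemma ends_if_small_to_big_pair:
  assumes N: "c \<in> N" "d \<in> N" "k \<in> N" and big: "\<not> small c d" and s: "small k c" "small k d"
  shows "\<not> between k"
proof
  assume k: "between k"
  have d: "distinct [c, d, k]" using big s small_self small_sym N by auto
  define h s where "h = defect c d + 2 * (pos c * pos d)" and "s = pos c + pos d - 1"
  have hs: "h \<in> multiples e" "s \<in> multiples e"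
    using big_pair[OF N(1,2) big] by (auto simp: h_def s_def)
  have mem: "pos c \<in> R" "pos d \<in> R" "pos k \<in> R" "defect c d \<in> R"
    using N by (auto intro: pos_mem defect_mem)
  define g t where "g = defect c d * (defect c d + 2 * ((pos c - pos k) * (pos d - pos k)))"
    and "t = 2 * (2 * (pos c * pos d * pos k)) * s
      + (defect c d + 2 * ((pos c - pos k) * (pos d - pos k)) - 2 * (pos c * pos d)) * h"
  have "small c k" "small d k" using assms small_sym by auto
  then have "g \<in> multiples e"
    unfolding g_def by (intro defect_quadratic N d)
  moreover have "t \<in> multiples e"
    unfolding t_def by (intro multiples_add multiples_multL multiples_multR hs closed mem)
  ultimately have "g - t \<in> multiples e" by (rule multiples_diff)
  moreover have "g - t = 2 * (2 * ((pos c * pos d) * (pos k * (1 - pos k))))"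
    unfolding g_def t_def h_def s_def by (simp add: algebra_simps)
  ultimately have "2 * (2 * ((pos c * pos d) * (pos k * (1 - pos k)))) \<in> multiples e"
    by simp
  then have "2 * (2 * ((pos c * pos d) * (pos k * (1 - pos k)))) \<in> maxideal"
    by (rule multiples_maxideal[OF e_max])
  moreover have "2 * (2 * ((pos c * pos d) * (pos k * (1 - pos k)))) \<in> units"
    using big_pair[OF N(1,2) big] k unfolding between_def by (intro unit_mult two_unit) auto
  ultimately show False using maxideal_not_unit by blast
qed

lemma big_pair_y: 
  assumes N: "i \<in> N" "j \<in> N" and big: "\<not> small i j"
  shows "y i j - 1 \<in> multiples e"
proof -
  have "y i j - 1 = (pos i + pos j + 1) * (pos i + pos j - 1)
      - 2 * (defect i j + 2 * (pos i * pos j))"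
    by (simp add: y_eq power2_eq_square algebra_simps)
  also have "\<dots> \<in> multiples e"
    by (intro multiples_diff[OF multiples_multL multiples_multL] big_pair[OF N big] closed pos_mem N)
  finally show ?thesis .
qed

text \<open>
  Such a triangle would be equilateral with side one modulo \<open>e\<close>, hence not degenerate: its Heron
  expression would be \<open>3\<close>.
\<close>
lemma no_big_triangle:
  assumes N: "i \<in> N" "j \<in> N" "k \<in> N" and big: "\<not> small i k" "\<not> small j k" "\<not> small i j"
  shows False
proof -
  have d: "distinct [i, j, k]" using big small_self N by auto
  define u v w where "u = y i k - 1" and "v = y j k - 1" and "w = y i j - 1"
  have uvw: "u \<in> multiples e" "v \<in> multiples e" "w \<in> multiples e"
    using big_pair_y N big by (auto simp: u_def v_def w_def)
  have mem: "u \<in> R" "v \<in> R" "w \<in> R"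
    using uvw multiples_subset[OF maxideal_mem[OF e_max]] by auto
  have "3 = heron (y i k) (y j k) (y i j) - u * (2 - u + 2 * v + 2 * w)
      - v * (2 - v + 2 * w) - w * (2 - w)"
    unfolding heron_def u_def v_def w_def by (simp add: power2_eq_square algebra_simps)
  also have "\<dots> \<in> multiples e"
    by (intro multiples_diff heron_multiple N d multiples_multR uvw closed mem)
  finally have "3 \<in> maxideal" by (rule multiples_maxideal[OF e_max])
  then show False using maxideal_not_unit three_unit by blast
qed

text \<open>
  If all pairs are small, the points lie on the line. Otherwise fix a pair \<open>c d\<close> that is not small.
  The points between the ends then fall into two classes, those that form a pair that is not small with
  \<open>c\<close> and those that do so with \<open>d\<close>, and a pair is not small exactly if it joins the two
  classes. The functions \<open>q\<close> and \<open>r\<close> are \<open>pos\<close> restricted to the two classes, so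
  that the product \<open>4 * (q i - q j) * (r i - r j)\<close> is \<open>-4 * pos i * pos j\<close>, twice the
  defect, on the pairs that join them and zero on the others.
\<close>
lemma distances_rank_three:
  "\<exists>p q r. (\<forall>i\<in>N. p i \<in> R \<and> q i \<in> R \<and> r i \<in> R) \<and>
     (\<forall>i\<in>N. \<forall>j\<in>N. y i j - ((p i - p j)\<^sup>2 - 4 * (q i - q j) * (r i - r j)) \<in> multiples e)"
proof (cases "\<exists>c\<in>N. \<exists>d\<in>N. \<not> small c d")
  case False
  have "y i j - (pos i - pos j)\<^sup>2 \<in> multiples e" if "i \<in> N" "j \<in> N" for i j
  proof -
    have "y i j - (pos i - pos j)\<^sup>2 = (- 2) * defect i j" by (simp add: y_eq)
    also have "\<dots> \<in> multiples e"
      using that False by (intro multiples_multL closed) (auto simp: small_def)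
    finally show ?thesis .
  qed
  then show ?thesis
    by (intro exI[of _ pos] exI[of _ "\<lambda>_. 0"]) (auto simp: pos_mem zero_mem)
next
  case True
  then obtain c d where cd: "c \<in> N" "d \<in> N" "\<not> small c d" by blast
  define q r where "q = (\<lambda>i. if small i c then 0 else pos i)"
    and "r = (\<lambda>i. if small i d then 0 else pos i)"
  have excl: "small i c \<or> small i d" if "i \<in> N" for i
    using no_big_triangle[of c d i] cd that small_sym by blast
  have cover: "\<not> small i c \<or> \<not> small i d" if "i \<in> N" "between i" for i
    using ends_if_small_to_big_pair[OF cd(1,2) that(1) cd(3)] that by blast
  have big_iff: "\<not> small i j \<longleftrightarrow> \<not> small i c \<and> \<not> small j d \<or> \<not> small i d \<and> \<not> small j c"
    if N: "i \<in> N" "j \<in> N" for i j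
  proof
    assume big: "\<not> small i j"
    have "\<not> (\<not> small i k \<and> \<not> small j k)" if "k \<in> N" for k
      using no_big_triangle[OF N that] big by blast
    then show "\<not> small i c \<and> \<not> small j d \<or> \<not> small i d \<and> \<not> small j c"
      using cover N big_pair[OF N big] cd by metis
  next
    have *: "\<not> small i' j'" if N': "i' \<in> N" "j' \<in> N" and n: "\<not> small i' c" "\<not> small j' d" for i' j'
    proof
      assume "small i' j'"
      moreover have "small j' c" using excl[OF N'(2)] n by blast
      moreover have "between j'" using big_pair[OF N'(2) cd(2) n(2)] by blast
      ultimately show False
        using ends_if_small_to_big_pair[OF N'(1) cd(1) N'(2) n(1)] small_sym N' by blast
    qed
    assume "\<not> small i c \<and> \<not> small j d \<or> \<not> small i d \<and> \<not> small j c"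
    then show "\<not> small i j" using *[of i j] *[of j i] small_sym N by blast
  qed
  have "y i j - ((pos i - pos j)\<^sup>2 - 4 * (q i - q j) * (r i - r j)) \<in> multiples e"
    if N: "i \<in> N" "j \<in> N" for i j
  proof -
    have split: "y i j - ((pos i - pos j)\<^sup>2 - 4 * (q i - q j) * (r i - r j))
        = 4 * ((q i - q j) * (r i - r j)) - 2 * defect i j"
      by (simp add: y_eq mult.assoc)
    show ?thesis
    proof (cases "small i j")
      case True
      then have "q i * r j = 0" "q j * r i = 0" "q i * r i = 0" "q j * r j = 0"
        using big_iff[OF N] excl[OF N(1)] excl[OF N(2)] by (auto simp: q_def r_def)
      then have "(q i - q j) * (r i - r j) = 0" by auto
      then have "y i j - ((pos i - pos j)\<^sup>2 - 4 * (q i - q j) * (r i - r j)) = (- 2) * defect i j"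
        unfolding split by simp
      also have "\<dots> \<in> multiples e"
        using True by (intro multiples_multL closed) (auto simp: small_def)
      finally show ?thesis .
    next
      case False
      then have "\<not> small i c \<and> \<not> small j d \<or> \<not> small i d \<and> \<not> small j c"
        using big_iff N by blast
      then have "(q i - q j) * (r i - r j) = - (pos i * pos j)"
        using excl[OF N(1)] excl[OF N(2)] by (auto simp: q_def r_def)
      then have "y i j - ((pos i - pos j)\<^sup>2 - 4 * (q i - q j) * (r i - r j))
          = (- 2) * (defect i j + 2 * (pos i * pos j))"
        unfolding split by simp
      also have "\<dots> \<in> multiples e"
        using big_pair[OF N False] by (intro multiples_multL closed)
      finally show ?thesis .
    qed
  qed
  moreover have "\<forall>i\<in>N. pos i \<in> R \<and> q i \<in> R \<and> r i \<in> R"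
    by (auto simp: q_def r_def pos_mem zero_mem)
  ultimately show ?thesis by blast
qed

end

section \<open>Determinants of nearly low-rank matrices\<close>

lemma (in field_subring) of_int_mem: "of_int m \<in> R"
  by (cases m) (auto intro: of_nat_mem minus_mem simp del: of_nat_Suc)

lemma (in field_subring) det_mem:
  fixes A :: "'k^'n^'n"
  assumes "\<And>i j. A $ i $ j \<in> R"
  shows "det A \<in> R"
  unfolding det_def by (intro sum_mem mult_mem prod_mem of_int_mem assms)

text \<open>
  In the terms of the multilinear expansion in all rows, each row is either one of the \<open>card S\<close>
  vectors \<open>\<beta> k\<close> or a multiple of \<open>e\<close>. A term in which some \<open>\<beta> k\<close> occurs twice vanishes, so all
  other terms have at least \<open>CARD('n) - card S\<close> rows that are multiples of \<open>e\<close>. The rows in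
  \<open>T\<close> are those not expanded yet.
\<close>
lemma (in field_subring) det_low_rank_rows:
  fixes c :: "'n::finite \<Rightarrow> 'k^'n" and \<beta> :: "'b \<Rightarrow> 'k^'n"
  assumes S: "finite S" and e: "e \<in> R" and \<beta>: "\<And>k j. k \<in> S \<Longrightarrow> \<beta> k $ j \<in> R"
    and T: "finite T"
    and mixed: "\<And>i. i \<in> T \<Longrightarrow> \<exists>\<alpha> d. (\<forall>k\<in>S. \<alpha> k \<in> R) \<and> (\<forall>j. d $ j \<in> multiples e) \<and>
                 c i = (\<Sum>k\<in>S. \<alpha> k *s \<beta> k) + d"
    and pure: "\<And>i. i \<notin> T \<Longrightarrow> (\<exists>k\<in>S. c i = \<beta> k) \<or> (\<forall>j. c i $ j \<in> multiples e)"
  shows "det (\<chi> i. c i) \<in> multiples (e ^ (CARD('n) - card S))"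
  using T mixed pure
proof (induction T arbitrary: c rule: finite_induct)
  case empty
  define P where "P = {i. \<exists>k\<in>S. c i = \<beta> k}"
  have "\<forall>i\<in>P. \<exists>k. k \<in> S \<and> c i = \<beta> k" by (auto simp: P_def)
  then obtain \<kappa> where \<kappa>: "\<And>i. i \<in> P \<Longrightarrow> \<kappa> i \<in> S \<and> c i = \<beta> (\<kappa> i)"
    by (metis bchoice)
  show ?case
  proof (cases "inj_on \<kappa> P")
    case True
    then have "card P \<le> card S" using \<kappa> S by (intro card_inj_on_le) auto
    define u where "u = (\<lambda>i. if i \<in> P then 1 else e)"
    have "\<exists>c'. c i = u i *s c' \<and> (\<forall>j. c' $ j \<in> R)" for i
    proof (cases "i \<in> P")
      case True
      then show ?thesis using \<kappa>[OF True] \<beta> by (intro exI[of _ "c i"]) (auto simp: u_def)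
    next
      case False
      then have "\<forall>j. \<exists>z\<in>R. c i $ j = e * z"
        using empty.prems(2)[of i] by (auto simp: P_def multiples_def)
      then obtain z where "\<And>j. z j \<in> R \<and> c i $ j = e * z j" by metis
      then show ?thesis using False by (intro exI[of _ "\<chi> j. z j"]) (auto simp: u_def vec_eq_iff)
    qed
    then obtain c' where c': "\<And>i. c i = u i *s c' i" "\<And>i j. c' i $ j \<in> R" by metis
    have "CARD('n) - card S \<le> card (- P)"
      using \<open>card P \<le> card S\<close> by (simp add: Compl_eq_Diff_UNIV card_Diff_subset)
    then obtain l where l: "card (- P) = (CARD('n) - card S) + l" using le_Suc_ex by blast
    have "det (\<chi> i. c i) = prod u UNIV * det (\<chi> i. c' i)"
      unfolding c'(1) by (rule det_rows_mul)
    also have "prod u UNIV = prod u (- P)"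
      by (rule prod.mono_neutral_right) (auto simp: u_def)
    also have "\<dots> = e ^ card (- P)" by (simp add: u_def)
    also have "e ^ card (- P) * det (\<chi> i. c' i)
        = e ^ (CARD('n) - card S) * (e ^ l * det (\<chi> i. c' i))"
      by (simp add: l power_add)
    also have "\<dots> \<in> multiples (e ^ (CARD('n) - card S))"
      by (intro multiplesI mult_mem power_mem e det_mem) (simp add: c'(2))
    finally show ?thesis .
  next
    case False
    then obtain i j where "i \<in> P" "j \<in> P" "i \<noteq> j" "\<kappa> i = \<kappa> j" by (auto simp: inj_on_def)
    then have "det (\<chi> i. c i) = 0"
      using \<kappa> by (intro det_identical_rows[of i j]) (auto simp: row_def)
    then show ?thesis by (simp add: multiples_zero)
  qed
next
  case (insert t T)
  obtain \<alpha> d where \<alpha>: "\<And>k. k \<in> S \<Longrightarrow> \<alpha> k \<in> R" and d: "\<And>j. d $ j \<in> multiples e"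
    and ct: "c t = (\<Sum>k\<in>S. \<alpha> k *s \<beta> k) + d"
    using insert.prems(1)[of t] by auto
  let ?M = "multiples (e ^ (CARD('n) - card S))"
  have IH: "det (\<chi> i. if i = t then w else c i) \<in> ?M"
    if "(\<exists>k\<in>S. w = \<beta> k) \<or> (\<forall>j. w $ j \<in> multiples e)" for w
  proof (rule insert.IH)
    fix i assume "i \<in> T"
    then have "(if i = t then w else c i) = c i" using insert.hyps(2) by auto
    then show "\<exists>\<alpha> d. (\<forall>k\<in>S. \<alpha> k \<in> R) \<and> (\<forall>j. d $ j \<in> multiples e) \<and>
        (if i = t then w else c i) = (\<Sum>k\<in>S. \<alpha> k *s \<beta> k) + d"
      using insert.prems(1)[of i] \<open>i \<in> T\<close> by (simp del: if_split)
  next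
    fix i assume "i \<notin> T"
    then show "(\<exists>k\<in>S. (if i = t then w else c i) = \<beta> k) \<or>
        (\<forall>j. (if i = t then w else c i) $ j \<in> multiples e)"
      using insert.prems(2)[of i] that by (cases "i = t") auto
  qed
  have "det (\<chi> i. c i) = det (\<chi> i. if i = t then (\<Sum>k\<in>S. \<alpha> k *s \<beta> k) + d else c i)"
    using ct by (intro arg_cong[of _ _ det]) (auto simp: vec_eq_iff)
  also have "\<dots> = det (\<chi> i. if i = t then (\<Sum>k\<in>S. \<alpha> k *s \<beta> k) else c i) + det (\<chi> i. if i = t then d else c i)"
    by (rule det_row_add)
  also have "det (\<chi> i. if i = t then (\<Sum>k\<in>S. \<alpha> k *s \<beta> k) else c i)
      = (\<Sum>k\<in>S. det (\<chi> i. if i = t then \<alpha> k *s \<beta> k else c i))"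
    by (rule det_linear_row_sum[OF S])
  also have "\<dots> = (\<Sum>k\<in>S. \<alpha> k * det (\<chi> i. if i = t then \<beta> k else c i))"
    by (simp add: det_row_mul)
  finally have eq: "det (\<chi> i. c i) = (\<Sum>k\<in>S. \<alpha> k * det (\<chi> i. if i = t then \<beta> k else c i))
      + det (\<chi> i. if i = t then d else c i)" .
  have "(\<Sum>k\<in>A. \<alpha> k * det (\<chi> i. if i = t then \<beta> k else c i)) \<in> ?M" if "A \<subseteq> S" for A
    using that S
  proof (induction A rule: infinite_finite_induct)
    case (insert k A)
    then show ?case by (auto intro!: multiples_add multiples_multL IH \<alpha>)
  qed (auto simp: multiples_zero)
  then show ?case unfolding eq using IH d by (intro multiples_add) auto
qed

section \<open>Boundedness of the Gram determinant\<close>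

context thin_distances
begin

text \<open>
  Polarizing the form \<open>p\<^sup>2 - 4 * q * r\<close> gives
  \<open>P i * P j - 2 * Q i * S j - 2 * S i * Q j\<close>, so modulo \<open>e\<close> the rows of the Gram matrix
  based at the vertex \<open>z\<close> are combinations of the three vectors \<open>P\<close>, \<open>S\<close>, \<open>Q\<close>.
\<close>
lemma gram_det_multiple:
  fixes f :: "'n::finite \<Rightarrow> 'i"
  assumes f: "range f \<subseteq> N" and z: "z \<in> N"
  shows "det (\<chi> i j. (y (f i) z + y (f j) z - y (f i) (f j)) / 2 :: 'k^'n^'n)
           \<in> multiples (e ^ (CARD('n) - 3))"
proof -
  obtain p q r where pqr: "\<And>i. i \<in> N \<Longrightarrow> p i \<in> R \<and> q i \<in> R \<and> r i \<in> R"
    and y: "\<And>i j. i \<in> N \<Longrightarrow> j \<in> N \<Longrightarrow>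
       y i j - ((p i - p j)\<^sup>2 - 4 * (q i - q j) * (r i - r j)) \<in> multiples e"
    using distances_rank_three by blast
  define P Q S where "P i = p (f i) - p z" and "Q i = q (f i) - q z" and "S i = r (f i) - r z" for i
  define \<beta> :: "nat \<Rightarrow> 'k^'n" where
    "\<beta> k = (\<chi> j. if k = 0 then P j else if k = 1 then S j else Q j)" for k
  define \<alpha> :: "'n \<Rightarrow> nat \<Rightarrow> 'k" where
    "\<alpha> i k = (if k = 0 then P i else if k = 1 then - 2 * Q i else - 2 * S i)" for i k
  define c :: "'n \<Rightarrow> 'k^'n" where
    "c i = (\<chi> j. (y (f i) z + y (f j) z - y (f i) (f j)) / 2)" for i
  have fN: "f i \<in> N" for i using f by blast
  have PQS: "P i \<in> R" "Q i \<in> R" "S i \<in> R" for i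
    using pqr fN z by (auto simp: P_def Q_def S_def intro: diff_mem)
  have "det (\<chi> i. c i) \<in> multiples (e ^ (CARD('n) - card {0, 1, 2 :: nat}))"
  proof (rule det_low_rank_rows[where T = UNIV and \<beta> = \<beta>])
    show "\<beta> k $ j \<in> R" for k j using PQS by (simp add: \<beta>_def)
    show "\<exists>\<alpha> d. (\<forall>k\<in>{0, 1, 2}. \<alpha> k \<in> R) \<and> (\<forall>j. d $ j \<in> multiples e) \<and>
           c i = (\<Sum>k\<in>{0, 1, 2}. \<alpha> k *s \<beta> k) + d" for i
    proof (intro exI conjI allI ballI)
      show "\<alpha> i k \<in> R" for k using PQS by (auto simp: \<alpha>_def intro!: closed)
      show "c i = (\<Sum>k\<in>{0, 1, 2}. \<alpha> i k *s \<beta> k) + (c i - (\<Sum>k\<in>{0, 1, 2}. \<alpha> i k *s \<beta> k))"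
        by simp
      show "(c i - (\<Sum>k\<in>{0, 1, 2}. \<alpha> i k *s \<beta> k)) $ j \<in> multiples e" for j
      proof -
        define E where "E i j = y i j - ((p i - p j)\<^sup>2 - 4 * (q i - q j) * (r i - r j))" for i j
        have yE: "y i j = E i j + ((p i - p j)\<^sup>2 - 4 * (q i - q j) * (r i - r j))" for i j
          by (simp add: E_def)
        have "E (f i) z + E (f j) z - E (f i) (f j) \<in> multiples e"
          unfolding E_def by (intro multiples_add multiples_diff[OF multiples_add] y fN z)
        moreover have "2 * (c i - (\<Sum>k\<in>{0, 1, 2}. \<alpha> i k *s \<beta> k)) $ j
            = E (f i) z + E (f j) z - E (f i) (f j)"
        proof -
          have "2 * c i $ j = y (f i) z + y (f j) z - y (f i) (f j)" by (simp add: c_def)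
          moreover have "(\<Sum>k\<in>{0, 1, 2}. \<alpha> i k *s \<beta> k) $ j = P i * P j - 2 * Q i * S j - 2 * S i * Q j"
            by (simp add: \<alpha>_def \<beta>_def)
          ultimately have "2 * (c i - (\<Sum>k\<in>{0, 1, 2}. \<alpha> i k *s \<beta> k)) $ j
              = y (f i) z + y (f j) z - y (f i) (f j) - 2 * (P i * P j - 2 * Q i * S j - 2 * S i * Q j)"
            by (simp only: vector_minus_component right_diff_distrib)
          also have "\<dots> = E (f i) z + E (f j) z - E (f i) (f j)"
            by (simp add: yE P_def Q_def S_def power2_eq_square algebra_simps)
          finally show ?thesis .
        qed
        ultimately show ?thesis using multiples_unit_cancel[OF _ two_unit] by metis
      qed
    qed
  qed (auto intro: maxideal_mem[OF e_max])
  then show ?thesis by (simp add: c_def numeral_3_eq_3)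
qed

end

context valuation_subring
begin

text \<open>
  Divisibility is a total preorder in a valuation ring.
\<close>
lemma ex_largest:
  assumes "finite A" "A \<noteq> {}"
  shows "\<exists>m\<in>A. \<forall>a\<in>A. \<exists>z\<in>R. g a = z * g m"
  using assms
proof (induction A rule: finite_ne_induct)
  case (singleton a)
  then show ?case by (auto intro!: bexI[of _ 1] one_mem)
next
  case (insert a A)
  then obtain m where m: "m \<in> A" "\<And>b. b \<in> A \<Longrightarrow> \<exists>z\<in>R. g b = z * g m" by blast
  show ?case
  proof (cases "\<exists>z\<in>R. g a = z * g m")
    case True
    then show ?thesis using m by blast
  next
    case False
    have "g a \<noteq> 0" using False zero_mem by auto
    have "\<exists>w\<in>R. g m = w * g a"
    proof (cases "g m = 0")
      case True
      then show ?thesis using zero_mem by auto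
    next
      case gm: False
      have "g a / g m \<notin> R" using False gm by auto
      then have "g m / g a \<in> R" using mem_or_inverse[of "g a / g m"] by simp
      then show ?thesis using \<open>g a \<noteq> 0\<close> by (intro bexI[of _ "g m / g a"]) auto
    qed
    then obtain w where w: "w \<in> R" "g m = w * g a" by blast
    have "\<exists>z\<in>R. g b = z * g a" if b: "b \<in> insert a A" for b
    proof (cases "b = a")
      case True
      then show ?thesis using one_mem by (intro bexI[of _ 1]) simp_all
    next
      case False
      then obtain z where z: "z \<in> R" "g b = z * g m" using m(2)[of b] b by blast
      have "g b = (z * w) * g a" unfolding z(2) w(2) by (rule mult.assoc[symmetric])
      then show ?thesis using mult_mem[OF z(1) w(1)] by blast
    qed
    then show ?thesis by blast
  qed
qed

text \<open>
  The matrix is the Gram matrix of the vectors from \<open>z\<close> to the other vertices, written in terms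
  of squared distances. If these are not all in \<open>R\<close>, dividing by a largest one, \<open>L\<close>, makes all
  triangles thin with \<open>e = 1 / L\<^sup>2\<close>; the power of \<open>e\<close> that divides the rescaled determinant
  makes up for the factor \<open>L ^ CARD('n)\<close>.
\<close>
lemma gram_det_mem:
  fixes x :: "'i \<Rightarrow> 'i \<Rightarrow> 'k" and f :: "'n::finite \<Rightarrow> 'i"
  assumes half: "1 / 2 \<in> R" and third: "1 / 3 \<in> R" and dim: "CARD('n) \<ge> 6"
    and f: "inj f" "z \<notin> range f" "N = insert z (range f)"
    and sym: "\<And>i j. i \<in> N \<Longrightarrow> j \<in> N \<Longrightarrow> x i j = x j i" and self: "\<And>i. i \<in> N \<Longrightarrow> x i i = 0"
    and area: "\<And>i j k. i \<in> N \<Longrightarrow> j \<in> N \<Longrightarrow> k \<in> N \<Longrightarrow> distinct [i, j, k] \<Longrightarrow>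
           heron (x i k) (x j k) (x i j) \<in> units"
  shows "det (\<chi> i j. (x (f i) z + x (f j) z - x (f i) (f j)) / 2 :: 'k^'n^'n) \<in> R"
proof -
  have fN: "f i \<in> N" for i using f by auto
  have zN: "z \<in> N" using f by auto
  have N: "finite N" "card N = Suc (CARD('n))"
    using f by (auto simp: card_image)
  obtain a b where ab: "a \<in> N" "b \<in> N" "\<And>i j. i \<in> N \<Longrightarrow> j \<in> N \<Longrightarrow> \<exists>w\<in>R. x i j = w * x a b"
  proof -
    have "N \<times> N \<noteq> {}" "finite (N \<times> N)" using zN N(1) by auto
    then obtain c where "c \<in> N \<times> N" "\<forall>a\<in>N \<times> N. \<exists>w\<in>R. (case a of (i, j) \<Rightarrow> x i j) = w * (case c of (i, j) \<Rightarrow> x i j)"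
      using ex_largest[of "N \<times> N" "\<lambda>(i, j). x i j"] by blast
    then show thesis by (intro that[of "fst c" "snd c"]) (auto simp: case_prod_beta)
  qed
  define L where "L = x a b"
  show ?thesis
  proof (cases "L \<in> R")
    case True
    have xR: "x i j \<in> R" if "i \<in> N" "j \<in> N" for i j
      using ab(3)[OF that] True by (auto simp: L_def intro: mult_mem)
    have "(x (f i) z + x (f j) z - x (f i) (f j)) * (1 / 2) \<in> R" for i j
      by (intro closed half xR fN zN)
    then show ?thesis by (intro det_mem) simp
  next
    case False
    then have L: "L \<noteq> 0" "inverse L \<in> R" using zero_mem mem_or_inverse by auto
    define y where "y i j = x i j / L" for i j
    have xy: "x i j = L * y i j" for i j using L by (simp add: y_def)
    interpret thin_distances R N y "(inverse L)\<^sup>2" a b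
    proof unfold_locales
      have "inverse L \<in> maxideal" using L False by (auto simp: maxideal_def units_def)
      then show "(inverse L)\<^sup>2 \<in> maxideal" by (intro maxideal_power) auto
      show "y i j \<in> R" if "i \<in> N" "j \<in> N" for i j
        using ab(3)[OF that] L by (auto simp: y_def L_def)
      show "\<exists>u\<in>units. heron (y i k) (y j k) (y i j) = (inverse L)\<^sup>2 * u"
        if "i \<in> N" "j \<in> N" "k \<in> N" "distinct [i, j, k]" for i j k
        using area[OF that] L
        by (intro bexI[of _ "heron (x i k) (x j k) (x i j)"])
          (auto simp: xy heron_def field_simps power2_eq_square)
      show "y a b = 1" using L by (simp add: y_def L_def[symmetric])
    qed (use N ab sym self L half third dim in \<open>auto simp: y_def\<close>)
    have "det (\<chi> i j. (x (f i) z + x (f j) z - x (f i) (f j)) / 2 :: 'k^'n^'n)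
        = det (\<chi> i. L *s (\<chi> j. (y (f i) z + y (f j) z - y (f i) (f j)) / 2) :: 'k^'n^'n)"
      by (intro arg_cong[of _ _ det]) (simp add: vec_eq_iff xy algebra_simps)
    also have "\<dots> = L ^ CARD('n) * det (\<chi> i j. (y (f i) z + y (f j) z - y (f i) (f j)) / 2 :: 'k^'n^'n)"
      by (subst det_rows_mul) simp
    finally have eq: "det (\<chi> i j. (x (f i) z + x (f j) z - x (f i) (f j)) / 2 :: 'k^'n^'n)
      = L ^ CARD('n) * det (\<chi> i j. (y (f i) z + y (f j) z - y (f i) (f j)) / 2 :: 'k^'n^'n)" .
    obtain w where w: "w \<in> R" "det (\<chi> i j. (y (f i) z + y (f j) z - y (f i) (f j)) / 2 :: 'k^'n^'n)
        = ((inverse L)\<^sup>2) ^ (CARD('n) - 3) * w"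
      using gram_det_multiple[of f z] fN zN unfolding multiples_def by blast
    \<comment> \<open>Here the dimension has to be at least six: \<open>L ^ CARD('n)\<close> is cancelled entirely.\<close>
    have "2 * (CARD('n) - 3) = CARD('n) + (CARD('n) - 6)" using dim by simp
    then have "((inverse L)\<^sup>2) ^ (CARD('n) - 3) = inverse L ^ CARD('n) * inverse L ^ (CARD('n) - 6)"
      by (simp add: power_mult[symmetric] power_add[symmetric])
    then have "det (\<chi> i j. (x (f i) z + x (f j) z - x (f i) (f j)) / 2 :: 'k^'n^'n)
        = inverse L ^ (CARD('n) - 6) * w"
      unfolding eq w(2) using L by (simp add: field_simps)
    also have "\<dots> \<in> R" by (intro closed w L)
    finally show ?thesis .
  qed
qed

end

section \<open>Volume and areas in terms of distances\<close>

lemma triangle_area_squared: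
  fixes p q r :: "'a::euclidean_space"
  shows "16 * (triangle_area p q r)\<^sup>2 = heron ((dist p r)\<^sup>2) ((dist q r)\<^sup>2) ((dist p q)\<^sup>2)"
proof -
  \<comment> \<open>The square root in Heron's formula is undone by squaring only because, by the triangle inequality, all factors are nonnegative.\<close>
  define s where "s = (dist q r + dist p r + dist p q) / 2"
  have "s \<ge> 0" "s - dist q r \<ge> 0" "s - dist p r \<ge> 0" "s - dist p q \<ge> 0"
    using dist_triangle[of q r p] dist_triangle[of p r q] dist_triangle[of p q r]
    by (simp_all add: s_def dist_commute)
  then have "(triangle_area p q r)\<^sup>2 = s * (s - dist q r) * (s - dist p r) * (s - dist p q)"
    unfolding triangle_area_heron s_def[symmetric] by simp
  moreover have "2 * s = dist q r + dist p r + dist p q" by (simp add: s_def)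
  ultimately show ?thesis unfolding heron_def by algebra
qed

text \<open>
  The right-hand side is four times the Gram determinant of \<open>p - r\<close> and \<open>q - r\<close>. By the
  equality case of the Cauchy-Schwarz inequality it vanishes only for collinear points.
\<close>
lemma heron_gram:
  fixes p q r :: "'a::euclidean_space"
  shows "heron ((dist p r)\<^sup>2) ((dist q r)\<^sup>2) ((dist p q)\<^sup>2)
    = 4 * ((norm (p - r) * norm (q - r))\<^sup>2 - ((p - r) \<bullet> (q - r))\<^sup>2)"
proof -
  have "(dist p q)\<^sup>2 = (norm (p - r))\<^sup>2 + (norm (q - r))\<^sup>2 - 2 * ((p - r) \<bullet> (q - r))"
    by (simp add: dist_norm power2_norm_eq_inner inner_diff_left inner_diff_right inner_commute)
  then show ?thesis unfolding heron_def dist_norm by algebra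
qed

lemma triangle_area_nonzero:
  assumes "nondegenerate_simplex n p" "i < j" "j < k" "k \<le> n"
  shows "triangle_area (p i) (p j) (p k) \<noteq> 0"
proof
  assume 0: "triangle_area (p i) (p j) (p k) = 0"
  have cancel: "4 * (u - v) = 0 \<Longrightarrow> v = u" for u v :: real by simp
  have "4 * ((norm (p i - p k) * norm (p j - p k))\<^sup>2 - ((p i - p k) \<bullet> (p j - p k))\<^sup>2) = 0"
    unfolding heron_gram[symmetric] triangle_area_squared[symmetric] 0 by simp
  then have "\<bar>(p i - p k) \<bullet> (p j - p k)\<bar>\<^sup>2 = (norm (p i - p k) * norm (p j - p k))\<^sup>2"
    unfolding power2_abs by (rule cancel)
  then have "\<bar>(p i - p k) \<bullet> (p j - p k)\<bar> = norm (p i - p k) * norm (p j - p k)"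
    by (rule power2_eq_imp_eq) auto
  then have "collinear {p i, p k, p j}"
    unfolding norm_cauchy_schwarz_equal by (subst collinear_3) auto
  moreover have "p i \<noteq> p j" "p i \<noteq> p k" "p k \<noteq> p j"
    using assms inj_on_eq_iff[of p "{0..n}"] by (auto simp: nondegenerate_simplex_def)
  ultimately have "affine_dependent {p i, p k, p j}"
    by (simp add: collinear_3_eq_affine_dependent)
  moreover have "{p i, p k, p j} \<subseteq> p ` {0..n}" using assms by auto
  ultimately show False
    using assms(1) affine_dependent_subset unfolding nondegenerate_simplex_def by blast
qed

text \<open>
  A copy of a finite index type that inherits a well-order from the natural numbers, as
  \<open>content_simplex\<close> requires of the index type of the coordinates. Through
  \<open>Suc \<circ> Rep_idx\<close> it also enumerates the vertices of a simplex other than \<open>p 0\<close>.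
\<close>
typedef ('a::finite) idx = "{..<CARD('a)}"
  by (intro exI[of _ 0]) simp

setup_lifting type_definition_idx

instantiation idx :: (finite) wellorder
begin

lift_definition less_eq_idx :: "'a idx \<Rightarrow> 'a idx \<Rightarrow> bool" is "(\<le>)" .
lift_definition less_idx :: "'a idx \<Rightarrow> 'a idx \<Rightarrow> bool" is "(<)" .

instance
proof
  fix P :: "'a idx \<Rightarrow> bool" and x :: "'a idx"
  assume *: "\<And>x. (\<And>y. y < x \<Longrightarrow> P y) \<Longrightarrow> P x"
  show "P x"
  proof (induction x rule: measure_induct_rule[of Rep_idx])
    case (less x)
    then show ?case using * by (simp add: less_idx.rep_eq)
  qed
qed (transfer; auto)+

end

lemma bij_Rep_idx: "bij_betw Rep_idx (UNIV :: 'a::finite idx set) {..<CARD('a)}"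
  using type_definition.Rep_range[OF type_definition_idx] 
  by (auto simp: bij_betw_def inj_on_def Rep_idx_inject)

instance idx :: (finite) finite
proof
  show "finite (UNIV :: 'a idx set)"
    using bij_betw_finite[OF bij_Rep_idx] by simp
qed

lemma card_idx: "CARD('a::finite idx) = CARD('a)"
  using bij_betw_same_card[OF bij_Rep_idx] by simp

definition reindex :: "('m \<Rightarrow> 'n) \<Rightarrow> real^'n \<Rightarrow> real^'m" where
  "reindex b v = (\<chi> i. v $ b i)"

lemma linear_reindex: "linear (reindex b)"
  by (rule linearI) (simp_all add: reindex_def vec_eq_iff)

lemma inner_reindex:
  assumes "bij (b :: 'm::finite \<Rightarrow> 'n::finite)"
  shows "reindex b u \<bullet> reindex b v = u \<bullet> v"
  unfolding inner_vec_def reindex_def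
  using sum.reindex_bij_betw[OF assms, of "\<lambda>i. u $ i \<bullet> v $ i"] by simp

lemma inj_reindex: "bij b \<Longrightarrow> inj (reindex b)"
  by (rule injI) (auto simp: reindex_def vec_eq_iff bij_def surj_def, metis)

text \<open>
  Renaming coordinates maps boxes to boxes with the same edge lengths.
\<close>
lemma lborel_reindex:
  assumes b: "bij (b :: 'm::finite \<Rightarrow> 'n::finite)"
  shows "distr lborel borel (reindex b) = (lborel :: (real^'m) measure)"
proof (rule lborel_eqI[symmetric])
  have meas: "reindex b \<in> borel_measurable borel"
    by (intro borel_measurable_continuous_onI linear_continuous_on linear_conv_bounded_linear[THEN iffD1] linear_reindex)
  fix l u :: "real^'m" assume lu: "\<And>i. i \<in> Basis \<Longrightarrow> l \<bullet> i \<le> u \<bullet> i"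
  define l' u' :: "real^'n" where "l' = (\<chi> j. l $ inv b j)" and "u' = (\<chi> j. u $ inv b j)"
  have inv: "inv b (b i) = i" "b (inv b j) = j" for i j
    using b by (auto simp: bij_def surj_f_inv_f)
  have "reindex b -` box l u = box l' u'"
    unfolding box_def set_eq_iff vimage_eq mem_Collect_eq
    by (auto simp: reindex_def l'_def u'_def Basis_vec_def inner_axis inv) (metis inv)+
  moreover have "l' \<bullet> i \<le> u' \<bullet> i" if i: "i \<in> Basis" for i
  proof -
    obtain j where "i = axis j 1" using i by (auto simp: Basis_vec_def)
    then show ?thesis using lu[of "axis (inv b j) 1"] by (auto simp: Basis_vec_def l'_def u'_def inner_axis)
  qed
  ultimately have "emeasure (distr lborel borel (reindex b)) (box l u) = (\<Prod>i\<in>Basis. (u' - l') \<bullet> i)"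
    using meas by (simp add: emeasure_distr emeasure_lborel_box)
  also have "(\<Prod>i\<in>Basis. (u' - l') \<bullet> i) = (\<Prod>j\<in>UNIV. u' $ j - l' $ j)"
    by (simp add: Basis_vec_def prod.UNION_disjoint axis_eq_axis inner_axis)
  also have "\<dots> = (\<Prod>i\<in>UNIV. u' $ b i - l' $ b i)"
    using prod.reindex_bij_betw[OF b, of "\<lambda>j. u' $ j - l' $ j"] by simp
  also have "\<dots> = (\<Prod>i\<in>Basis. (u - l) \<bullet> i)"
    by (simp add: Basis_vec_def prod.UNION_disjoint axis_eq_axis inner_axis l'_def u'_def inv)
  finally show "emeasure (distr lborel borel (reindex b)) (box l u) = (\<Prod>i\<in>Basis. (u - l) \<bullet> i)" .
qed simp

lemma measure_hull_reindex:
  assumes b: "bij (b :: 'm::finite \<Rightarrow> 'n::finite)" and X: "finite X"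
  shows "measure lborel (convex hull (reindex b ` X)) = measure lborel (convex hull X)"
proof -
  have meas: "reindex b \<in> borel_measurable borel"
    by (intro borel_measurable_continuous_onI linear_continuous_on linear_conv_bounded_linear[THEN iffD1] linear_reindex)
  have hull: "convex hull (reindex b ` X) = reindex b ` (convex hull X)"
    by (simp add: convex_hull_linear_image linear_reindex)
  have "compact (convex hull (reindex b ` X))"
    using X by (intro finite_imp_compact_convex_hull) simp
  then have "reindex b ` (convex hull X) \<in> sets borel"
    unfolding hull by (intro borel_closed compact_imp_closed)
  then have "measure lborel (reindex b ` (convex hull X))
      = measure lborel (reindex b -` (reindex b ` (convex hull X)))"
    using meas by (subst lborel_reindex[OF b, symmetric], subst measure_distr) auto
  also have "reindex b -` (reindex b ` (convex hull X)) = convex hull X"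
    using inj_reindex[OF b] by (simp add: inj_vimage_image_eq)
  finally show ?thesis unfolding hull .
qed

text \<open>
  The volume is the determinant of the matrix \<open>M\<close> of edge vectors divided by a factorial, and the
  Gram matrix is \<open>transpose M ** M\<close>.
\<close>
lemma simplex_volume_gram:
  fixes p :: "nat \<Rightarrow> real^'n"
  assumes inj: "inj_on p {0..CARD('n)}"
  shows "(fact CARD('n) * measure lborel (convex hull (p ` {0..CARD('n)})))\<^sup>2
    = det (\<chi> i j. (p (Suc (Rep_idx i)) - p 0) \<bullet> (p (Suc (Rep_idx j)) - p 0) :: real^'n idx^'n idx)"
proof -
  have "\<exists>b :: 'n idx \<Rightarrow> 'n. bij b"
    using finite_same_card_bij[of "UNIV :: 'n idx set" "UNIV :: 'n set"] card_idx by auto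
  then obtain b :: "'n idx \<Rightarrow> 'n" where b: "bij b" by blast
  define q where "q m = reindex b (p m)" for m
  define f where "f i = q (Suc (Rep_idx i))" for i :: "'n idx"
  define X where "X = q ` {0..CARD('n)}"
  define M :: "real^'n idx^'n idx" where "M = (\<chi> i. \<chi> j. f j $ i - q 0 $ i)"
  have q: "inj_on q {0..CARD('n)}"
    using inj inj_reindex[OF b] by (auto simp: inj_on_def q_def)
  have "bij_betw (\<lambda>i :: 'n idx. Suc (Rep_idx i)) UNIV {1..CARD('n)}"
    using bij_betw_trans[OF bij_Rep_idx, of Suc "{1..CARD('n)}"]
    by (auto simp: bij_betw_def o_def image_Suc_lessThan)
  moreover have "bij_betw q {1..CARD('n)} (X - {q 0})"
  proof -
    have "{0..CARD('n)} = insert 0 {1..CARD('n)}" by auto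
    then have "X = insert (q 0) (q ` {1..CARD('n)})" unfolding X_def by simp
    moreover have "q 0 \<notin> q ` {1..CARD('n)}"
      using inj_onD[OF q, of 0] by force
    moreover have "inj_on q {1..CARD('n)}" by (rule inj_on_subset[OF q]) auto
    ultimately show ?thesis by (simp add: bij_betw_def)
  qed
  ultimately have f: "bij_betw f UNIV (X - {q 0})"
    using bij_betw_trans[of "\<lambda>i. Suc (Rep_idx i)" UNIV "{1..CARD('n)}" q "X - {q 0}"]
    by (simp add: f_def[abs_def] comp_def)
  have "measure lborel (convex hull X) = \<bar>det M\<bar> / fact CARD('n)"
    unfolding M_def card_idx[where 'a = 'n, symmetric]
  proof (rule content_simplex)
    show "bij_betw f UNIV (X - {q 0})" by (rule f)
  qed (auto simp: X_def card_idx card_image[OF q])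
  then have "(fact CARD('n) * measure lborel (convex hull X))\<^sup>2 = det (Finite_Cartesian_Product.transpose M ** M)"
    by (simp add: det_mul power2_eq_square)
  moreover have "X = reindex b ` (p ` {0..CARD('n)})" by (auto simp: X_def q_def)
  then have "measure lborel (convex hull X) = measure lborel (convex hull (p ` {0..CARD('n)}))"
    by (simp add: measure_hull_reindex[OF b])
  moreover have "Finite_Cartesian_Product.transpose M ** M
      = (\<chi> i j. (p (Suc (Rep_idx i)) - p 0) \<bullet> (p (Suc (Rep_idx j)) - p 0))"
  proof -
    have "(f i - q 0) \<bullet> (f j - q 0) = (p (Suc (Rep_idx i)) - p 0) \<bullet> (p (Suc (Rep_idx j)) - p 0)" for i j
      unfolding f_def q_def linear_diff[OF linear_reindex, symmetric] by (rule inner_reindex[OF b])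
    moreover have "(Finite_Cartesian_Product.transpose M ** M) $ i $ j = (f i - q 0) \<bullet> (f j - q 0)" for i j
      by (simp add: matrix_matrix_mult_def Finite_Cartesian_Product.transpose_def M_def inner_vec_def)
    ultimately show ?thesis unfolding vec_eq_iff by simp
  qed
  ultimately show ?thesis by simp
qed

section \<open>Finiteness of the set of volumes\<close>

lemma ultra_det: "ultra (\<lambda>m. det (A m)) = det (\<chi> i j. ultra (\<lambda>m. A m $ i $ j))"
  by (simp add: det_def ultra_sum ultra_mult ultra_of_int ultra_prod)

lemma ultra_heron: "ultra (\<lambda>m. heron (f m) (g m) (h m)) = heron (ultra f) (ultra g) (ultra h)"
  unfolding heron_def ultra_diff ultra_mult ultra_numeral ultra_power ultra_add ..

text \<open>
  The ring generated by the class of \<open>f\<close> over the reals.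
\<close>
definition polys_in :: "(nat \<Rightarrow> real) \<Rightarrow> ultrareal set" where
  "polys_in f = range (\<lambda>P. ultra (\<lambda>m. poly P (f m)))"

lemma polys_inI: "(\<And>m. g m = poly P (f m)) \<Longrightarrow> ultra g \<in> polys_in f"
  unfolding polys_in_def by (intro image_eqI[of _ _ P]) (auto intro: arg_cong[of _ _ ultra])

lemma field_subring_polys_in: "field_subring (polys_in f)"
proof
  show "1 \<in> polys_in f"
    using polys_inI[of "\<lambda>_. 1" 1 f] by (simp add: ultra_one)
  show "x - y \<in> polys_in f" "x * y \<in> polys_in f" if xy: "x \<in> polys_in f" "y \<in> polys_in f" for x y
  proof -
    obtain P Q where "x = ultra (\<lambda>m. poly P (f m))" "y = ultra (\<lambda>m. poly Q (f m))"
      using xy unfolding polys_in_def by blast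
    then show "x - y \<in> polys_in f" "x * y \<in> polys_in f"
      using polys_inI[of "\<lambda>m. poly P (f m) - poly Q (f m)" "P - Q" f]
        polys_inI[of "\<lambda>m. poly P (f m) * poly Q (f m)" "P * Q" f]
      by (simp_all add: ultra_diff ultra_mult)
  qed
qed

lemma const_in_polys: "ultra (\<lambda>_. c) \<in> polys_in f"
  by (rule polys_inI[of _ "[:c:]"]) simp

text \<open>
  If \<open>w = P (1 / w)\<close> at infinitely many indices, then the polynomial \<open>1 - X * P\<close> has infinitely
  many roots, although its value at \<open>0\<close> is \<open>1\<close>.
\<close>
lemma not_poly_in_inverse:
  assumes inj: "inj w" and nz: "\<And>m. w m \<noteq> 0"
  shows "ultra w \<notin> polys_in (\<lambda>m. inverse (w m))"
proof
  assume "ultra w \<in> polys_in (\<lambda>m. inverse (w m))"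
  then obtain P where P: "ultra w = ultra (\<lambda>m. poly P (inverse (w m)))" by (auto simp: polys_in_def)
  \<comment> \<open>\<open>Q = 1 - X * P\<close>\<close>
  define Q where "Q = pCons 1 (- P)"
  have "Q \<noteq> 0" by (simp add: Q_def)
  then have "finite {u. poly Q u = 0}" by (rule poly_roots_finite)
  moreover have "(\<lambda>m. inverse (w m)) ` {m. w m = poly P (inverse (w m))} \<subseteq> {u. poly Q u = 0}"
  proof clarify
    fix m assume m: "w m = poly P (inverse (w m))"
    have "poly Q (inverse (w m)) = 1 - inverse (w m) * poly P (inverse (w m))" by (simp add: Q_def)
    also have "\<dots> = 1 - inverse (w m) * w m" using m by simp
    finally show "poly Q (inverse (w m)) = 0" using nz by simp
  qed
  moreover have "inj_on (\<lambda>m. inverse (w m)) A" for A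
    using inj by (auto simp: inj_on_def)
  ultimately have "finite {m. w m = poly P (inverse (w m))}"
    using finite_imageD finite_subset by blast
  then show False using ultra_eq_infinitely_often[OF P] by blast
qed

lemma const_unit:
  assumes "field_subring R" "polys_in f \<subseteq> R" "c \<noteq> 0"
  shows "ultra (\<lambda>_. c) \<in> field_subring.units R"
proof -
  interpret field_subring R by fact
  have "ultra (\<lambda>_. c) * ultra (\<lambda>_. inverse c) = 1"
    using assms(3) by (simp add: ultra_mult[symmetric] ultra_one)
  then have "ultra (\<lambda>_. c) \<noteq> 0" "inverse (ultra (\<lambda>_. c)) = ultra (\<lambda>_. inverse c)"
    by (auto intro: inverse_unique)
  then show ?thesis
    using assms(2) const_in_polys unfolding units_def by auto
qed

text \<open>
  A sequence of distinct nonzero volumes gives an element \<open>ultra w\<close> of the ultrapower that lies outside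
  of the ring generated by its inverse over the reals, hence outside of some valuation ring \<open>R\<close>
  containing the reals. This contradicts \<open>gram_det_mem\<close>.
\<close>
lemma finite_volumes:
  fixes \<P> :: "(nat \<Rightarrow> real^'n) set"
  assumes dim: "CARD('n) \<ge> 6"
    and inj: "\<And>p. p \<in> \<P> \<Longrightarrow> inj_on p {0..CARD('n)}"
    and area: "\<And>i j k. i \<in> {0..CARD('n)} \<Longrightarrow> j \<in> {0..CARD('n)} \<Longrightarrow> k \<in> {0..CARD('n)} \<Longrightarrow>
      distinct [i, j, k] \<Longrightarrow> \<exists>c. c \<noteq> 0 \<and> (\<forall>p\<in>\<P>. triangle_area (p i) (p j) (p k) = c)"
  shows "finite ((\<lambda>p. measure lborel (convex hull (p ` {0..CARD('n)}))) ` \<P>)"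
proof (rule ccontr)
  define n where "n = CARD('n)"
  define vol where "vol p = measure lborel (convex hull (p ` {0..n}))" for p :: "nat \<Rightarrow> real^'n"
  assume "\<not> ?thesis"
  then have "infinite (vol ` \<P>)" by (simp add: vol_def[abs_def] n_def)
  then have "infinite (vol ` \<P> - {0})" by simp
  then obtain v :: "nat \<Rightarrow> real" where v: "inj v" "range v \<subseteq> vol ` \<P> - {0}"
    using infinite_countable_subset by blast
  then have "\<forall>m. \<exists>p. p \<in> \<P> \<and> v m = vol p \<and> v m \<noteq> 0" by blast
  then obtain p where p: "\<And>m. p m \<in> \<P>" "\<And>m. v m = vol (p m)" "\<And>m. v m \<noteq> 0" by metis
  define w where "w m = (fact n * v m)\<^sup>2" for m
  have w_nz: "w m \<noteq> 0" for m using p(3) by (simp add: w_def)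
  have "inj w"
  proof (rule injI)
    fix k l assume "w k = w l"
    then have "v k = v l"
      using power2_eq_iff_nonneg[of "fact n * v k" "fact n * v l"] by (simp add: w_def p(2) vol_def)
    then show "k = l" using v(1) by (simp add: inj_eq)
  qed
  define B where "B = polys_in (\<lambda>m. inverse (w m))"
  have "inverse (ultra w) \<in> B"
    using polys_inI[of "\<lambda>m. inverse (w m)" "[:0, 1:]" "\<lambda>m. inverse (w m)"] w_nz by (simp add: B_def ultra_inverse)
  then obtain R where R: "valuation_subring R" "B \<subseteq> R" "ultra w \<notin> R"
    using ex_valuation_subring[of B "ultra w"] not_poly_in_inverse[OF \<open>inj w\<close> w_nz]
      field_subring_polys_in B_def by blast
  interpret valuation_subring R by fact
  define x where "x i j = ultra (\<lambda>m. (dist (p m i) (p m j))\<^sup>2)" for i j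
  have const: "ultra (\<lambda>_. c) \<in> R" for c
    using R(2) const_in_polys by (auto simp: B_def)
  have "det (\<chi> i j. (x (Suc (Rep_idx i)) 0 + x (Suc (Rep_idx j)) 0
      - x (Suc (Rep_idx i)) (Suc (Rep_idx j))) / 2 :: ultrareal^'n idx^'n idx) \<in> R"
  proof (rule gram_det_mem[where N = "{0..n}" and f = "\<lambda>i :: 'n idx. Suc (Rep_idx i)" and z = 0])
    have inv: "1 / numeral k = ultra (\<lambda>_. inverse (numeral k))" for k
      by (subst ultra_inverse) (simp_all add: ultra_numeral inverse_eq_divide)
    show "1 / 2 \<in> R" "1 / 3 \<in> R" unfolding inv by (rule const)+
    show "CARD('n idx) \<ge> 6" using dim by (simp add: card_idx)
    show "inj (\<lambda>i :: 'n idx. Suc (Rep_idx i))" by (simp add: inj_def Rep_idx_inject)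
    show "0 \<notin> range (\<lambda>i :: 'n idx. Suc (Rep_idx i))" by auto
    show "{0..n} = insert 0 (range (\<lambda>i :: 'n idx. Suc (Rep_idx i)))"
    proof -
      have "range (\<lambda>i :: 'n idx. Suc (Rep_idx i)) = Suc ` range (Rep_idx :: 'n idx \<Rightarrow> nat)" by auto
      also have "\<dots> = {1..n}"
        using bij_Rep_idx[where 'a = 'n] by (simp add: bij_betw_def image_Suc_lessThan n_def)
      finally show ?thesis by auto
    qed
    show "x i j = x j i" for i j by (simp add: x_def dist_commute)
    show "x i i = 0" for i by (simp add: x_def ultra_zero)
    show "heron (x i k) (x j k) (x i j) \<in> units"
      if ijk: "i \<in> {0..n}" "j \<in> {0..n}" "k \<in> {0..n}" "distinct [i, j, k]" for i j k
    proof -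
      obtain c where c: "c \<noteq> 0" "\<And>q. q \<in> \<P> \<Longrightarrow> triangle_area (q i) (q j) (q k) = c"
        using area[of i j k] ijk by (auto simp: n_def)
      have "heron (x i k) (x j k) (x i j)
          = ultra (\<lambda>m. 16 * (triangle_area (p m i) (p m j) (p m k))\<^sup>2)"
        unfolding x_def ultra_heron[symmetric] triangle_area_squared ..
      also have "\<dots> = ultra (\<lambda>_. 16 * c\<^sup>2)" by (simp add: c(2) p(1))
      also have "\<dots> \<in> units"
        using R(2) c(1) by (intro const_unit field_subring_axioms) (auto simp: B_def)
      finally show ?thesis .
    qed
  qed
  moreover have "ultra w = det (\<chi> i j. (x (Suc (Rep_idx i)) 0 + x (Suc (Rep_idx j)) 0
      - x (Suc (Rep_idx i)) (Suc (Rep_idx j))) / 2 :: ultrareal^'n idx^'n idx)"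
  proof -
    define A :: "nat \<Rightarrow> real^'n idx^'n idx" where
      "A m = (\<chi> i j. (p m (Suc (Rep_idx i)) - p m 0) \<bullet> (p m (Suc (Rep_idx j)) - p m 0))" for m
    have "w m = det (A m)" for m
      unfolding w_def p(2) vol_def n_def A_def by (rule simplex_volume_gram) (rule inj[OF p(1)])
    then have "w = (\<lambda>m. det (A m))" by (rule ext)
    then have "ultra w = det (\<chi> i j. ultra (\<lambda>m. A m $ i $ j))" by (simp only: ultra_det)
    moreover have "ultra (\<lambda>m. (p m i - p m 0) \<bullet> (p m j - p m 0)) = (x i 0 + x j 0 - x i j) / 2" for i j
    proof -
      have "2 * ((p m i - p m 0) \<bullet> (p m j - p m 0))
          = (dist (p m i) (p m 0))\<^sup>2 + (dist (p m j) (p m 0))\<^sup>2 - (dist (p m i) (p m j))\<^sup>2" for m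
        by (simp add: dist_norm power2_norm_eq_inner inner_diff_left inner_diff_right inner_commute)
      then have "2 * ultra (\<lambda>m. (p m i - p m 0) \<bullet> (p m j - p m 0)) = x i 0 + x j 0 - x i j"
        unfolding x_def ultra_add[symmetric] ultra_diff[symmetric] ultra_numeral[symmetric] ultra_mult[symmetric]
        by simp
      then show ?thesis by (simp add: field_simps)
    qed
    ultimately show ?thesis by (simp add: A_def)
  qed
  ultimately show False using R(3) by simp
qed

theorem corollary1p8:
  fixes a :: "nat \<Rightarrow> nat \<Rightarrow> nat \<Rightarrow> real" and n :: nat
  assumes "n = CARD('n::finite)" and "n \<ge> 6"
  shows "finite {measure lborel (convex hull (p ` {0..n})) | p :: nat \<Rightarrow> real^'n.
           nondegenerate_simplex n p \<and>
           (\<forall>i j k. i < j \<and> j < k \<and> k \<le> n \<longrightarrow> triangle_area (p i) (p j) (p k) = a i j k)}"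
proof -
  define \<P> where "\<P> = {p :: nat \<Rightarrow> real^'n. nondegenerate_simplex n p \<and>
      (\<forall>i j k. i < j \<and> j < k \<and> k \<le> n \<longrightarrow> triangle_area (p i) (p j) (p k) = a i j k)}"
  have swap: "triangle_area x y z = triangle_area y x z" "triangle_area x y z = triangle_area x z y"
    for x y z :: "real^'n"
    unfolding triangle_area_heron by (simp_all only: dist_commute add_ac mult_ac)
  have sorted: "\<exists>c. c \<noteq> 0 \<and> (\<forall>p\<in>\<P>. triangle_area (p i) (p j) (p k) = c)"
    if ijk: "i < j" "j < k" "k \<le> n" for i j k
  proof (cases "\<P> = {}")
    case True
    then show ?thesis by (intro exI[of _ 1]) simp
  next
    case False
    then obtain p where "p \<in> \<P>" by blast
    then have "a i j k \<noteq> 0"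
      using triangle_area_nonzero[of n p i j k] ijk by (auto simp: \<P>_def)
    then show ?thesis using ijk by (intro exI[of _ "a i j k"]) (auto simp: \<P>_def)
  qed
  have "finite ((\<lambda>p. measure lborel (convex hull (p ` {0..CARD('n)}))) ` \<P>)"
  proof (rule finite_volumes)
    show "inj_on p {0..CARD('n)}" if "p \<in> \<P>" for p
      using that assms(1) by (simp add: \<P>_def nondegenerate_simplex_def)
    show "\<exists>c. c \<noteq> 0 \<and> (\<forall>p\<in>\<P>. triangle_area (p i) (p j) (p k) = c)"
      if ijk: "i \<in> {0..CARD('n)}" "j \<in> {0..CARD('n)}" "k \<in> {0..CARD('n)}" "distinct [i, j, k]" for i j k
    proof -
      have le: "i \<le> n" "j \<le> n" "k \<le> n" using ijk assms(1) by auto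
      consider "i < j" "j < k" | "i < k" "k < j" | "j < i" "i < k" | "j < k" "k < i"
        | "k < i" "i < j" | "k < j" "j < i"
        using ijk(4) by (auto simp: neq_iff)
      then show ?thesis
      proof cases
        case 1
        then show ?thesis using sorted le by blast
      next
        case 2
        then show ?thesis unfolding swap(2)[of "_ i" "_ j" "_ k"] using sorted le by blast
      next
        case 3
        then show ?thesis unfolding swap(1)[of "_ i" "_ j" "_ k"] using sorted le by blast
      next
        case 4
        then show ?thesis unfolding swap(1)[of "_ i" "_ j" "_ k"] swap(2)[of "_ j" "_ i" "_ k"]
          using sorted le by blast
      next
        case 5
        then show ?thesis unfolding swap(2)[of "_ i" "_ j" "_ k"] swap(1)[of "_ i" "_ k" "_ j"]
          using sorted le by blast
      next
        case 6
        then show ?thesis unfolding swap(1)[of "_ i" "_ j" "_ k"] swap(2)[of "_ j" "_ i" "_ k"]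
            swap(1)[of "_ j" "_ k" "_ i"]
          using sorted le by blast
      qed
    qed
  qed (use assms in simp)
  moreover have "{measure lborel (convex hull (p ` {0..n})) | p :: nat \<Rightarrow> real^'n.
           nondegenerate_simplex n p \<and>
           (\<forall>i j k. i < j \<and> j < k \<and> k \<le> n \<longrightarrow> triangle_area (p i) (p j) (p k) = a i j k)}
       = (\<lambda>p. measure lborel (convex hull (p ` {0..CARD('n)}))) ` \<P>"
    using assms(1) by (auto simp: \<P>_def)
  ultimately show ?thesis by simp
qed

end
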